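(* Let $S$ be a semigroup (of real Möbius transformations). Then at least one of the following holds: (i) $S$ is elementary; (ii) $S$ is semidiscrete; (iii) $S$ is contained in $\mathcal{M}(J)$ for some closed interval $J$; (iv) $S$ is dense in $\mathcal{M}$.
   Context: $\mathbb{H}$ is the upper half-plane, $\overline{\mathbb{R}}=\mathbb{R}\cup\{\infty\}$, $\overline{\mathbb{H}}=\mathbb{H}\cup\overline{\mathbb{R}}$. $\mathcal{M}\cong\mathrm{PSL}(2,\mathbb{R})$ is the topological group of real Möbius transformations $z\mapsto (az+b)/(cz+d)$ ($a,b,c,d\in\mathbb{R}$, $ad-bc>0$), with identity $I$. A semigroup is a nonempty subset of $\mathcal{M}$ closed under composition (not necessarily finitely generated). $S$ is elementary if it has a finite orbit in its action on $\overline{\mathbb{H}}$. $S$ is semidiscrete if $I$ is not an accumulation point of $S$ in $\mathcal{M}$. A closed interval is a closed interval in the circle $\overline{\mathbb{R}}$ that is neither a singleton nor all of $\overline{\mathbb{R}}$. For a closed interval $J$, $\mathcal{M}(J)=\{h\in\mathcal{M}: h(J)\subset J\}$. *)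

theory Defs
  imports "HOL-Analysis.Analysis"
begin

text \<open>
  The Riemann sphere is the one-point compactification of the complex plane, with \<open>None\<close> as the
  point at infinity.
\<close>

definition riemann_sphere :: "complex option topology" where
  "riemann_sphere = Alexandroff_compactification euclidean"

definition ext_real_line :: "complex option set" where
  "ext_real_line = insert None (Some ` \<real>)"

definition ext_upper_half_plane :: "complex option set" where
  "ext_upper_half_plane = Some ` {z. Im z > 0} \<union> ext_real_line"

text \<open>
  The Moebius transformation \<open>z \<mapsto> (a z + b) / (c z + d)\<close>, where \<open>a, b\<close> is the first and \<open>c, d\<close> the
  second row of the matrix, as a self-map of the Riemann sphere.
\<close>

definition mobius :: "real^2^2 \<Rightarrow> complex option \<Rightarrow> complex option" where
  "mobius A z =
    (let a = of_real (A $ 1 $ 1); b = of_real (A $ 1 $ 2);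
         c = of_real (A $ 2 $ 1); d = of_real (A $ 2 $ 2)
     in case z of
          None \<Rightarrow> if c = 0 then None else Some (a / c)
        | Some w \<Rightarrow> if c * w + d = 0 then None else Some ((a * w + b) / (c * w + d)))"

definition mobius_group :: "(complex option \<Rightarrow> complex option) set" where
  "mobius_group = mobius ` {A. det A > 0}"

text \<open>
  The topology of PSL(2,R): the quotient topology under \<open>mobius\<close>, which identifies two matrices
  of positive determinant if and only if they are proportional.
\<close>

definition mobius_topology :: "(complex option \<Rightarrow> complex option) topology" where
  "mobius_topology = topology (\<lambda>U. U \<subseteq> mobius_group \<and> open {A. det A > 0 \<and> mobius A \<in> U})"

lemma openin_mobius_topology:
  "openin mobius_topology U \<longleftrightarrow> U \<subseteq> mobius_group \<and> open {A. det A > 0 \<and> mobius A \<in> U}"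
proof -
  let ?P = "\<lambda>U. U \<subseteq> mobius_group \<and> open {A. det A > 0 \<and> mobius A \<in> U}"
  have "istopology ?P"
    unfolding istopology_def
  proof (intro conjI allI impI)
    fix U V assume "?P U" "?P V"
    moreover have "{A. det A > 0 \<and> mobius A \<in> U \<inter> V}
        = {A. det A > 0 \<and> mobius A \<in> U} \<inter> {A. det A > 0 \<and> mobius A \<in> V}"
      by auto
    ultimately show "U \<inter> V \<subseteq> mobius_group" "open {A. det A > 0 \<and> mobius A \<in> U \<inter> V}"
      by auto
  next
    fix K assume K: "\<forall>U\<in>K. ?P U"
    have eq: "{A. det A > 0 \<and> mobius A \<in> \<Union>K} = (\<Union>U\<in>K. {A. det A > 0 \<and> mobius A \<in> U})"
      by auto
    show "\<Union>K \<subseteq> mobius_group"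
      using K by blast
    show "open {A. det A > 0 \<and> mobius A \<in> \<Union>K}"
      unfolding eq using K by (intro open_UN) auto
  qed
  then show ?thesis
    unfolding mobius_topology_def by (simp add: topology_inverse')
qed

lemma open_det_pos: "open {A :: real^2^2. det A > 0}"
  by (intro open_Collect_less continuous_intros) (simp_all add: det_2 continuous_intros)

lemma topspace_mobius_topology [simp]: "topspace mobius_topology = mobius_group"
proof -
  have "{A. det A > 0 \<and> mobius A \<in> mobius_group} = {A. det A > 0}"
    by (auto simp: mobius_group_def)
  then have "openin mobius_topology mobius_group"
    by (simp add: openin_mobius_topology open_det_pos)
  then show ?thesis
    by (meson openin_mobius_topology openin_subset openin_topspace subset_antisym)
qed

lemma quotient_map_mobius:
  "quotient_map (top_of_set {A. det A > 0}) mobius_topology mobius"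
  by (auto simp: quotient_map_def openin_mobius_topology mobius_group_def
      openin_open_eq[OF open_det_pos])

definition mobius_semigroup :: "(complex option \<Rightarrow> complex option) set \<Rightarrow> bool" where
  "mobius_semigroup S \<longleftrightarrow>
    S \<noteq> {} \<and> S \<subseteq> mobius_group \<and> (\<forall>f\<in>S. \<forall>g\<in>S. f \<circ> g \<in> S)"

definition elementary :: "(complex option \<Rightarrow> complex option) set \<Rightarrow> bool" where
  "elementary S \<longleftrightarrow> (\<exists>z\<in>ext_upper_half_plane. finite ((\<lambda>f. f z) ` S))"

definition semidiscrete :: "(complex option \<Rightarrow> complex option) set \<Rightarrow> bool" where
  "semidiscrete S \<longleftrightarrow> id \<notin> mobius_topology derived_set_of S"

text \<open>
  The closed intervals of the circle are its nonempty, closed, connected subsets; so these may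
  contain the point at infinity, also as an end point.
\<close>

definition closed_interval :: "complex option set \<Rightarrow> bool" where
  "closed_interval J \<longleftrightarrow>
    closedin (subtopology riemann_sphere ext_real_line) J \<and>
    connectedin (subtopology riemann_sphere ext_real_line) J \<and>
    J \<noteq> {} \<and> \<not> is_singleton J \<and> J \<noteq> ext_real_line"

definition mobius_into :: "complex option set \<Rightarrow> (complex option \<Rightarrow> complex option) set" where
  "mobius_into J = {h \<in> mobius_group. h ` J \<subseteq> J}"

end

theory Submission
  imports Defs
begin

text \<open>
  Let \<open>G\<close> be the closure, among the matrices of positive determinant, of all matrices that represent
  elements of \<open>S\<close>. If \<open>S\<close> is not semidiscrete, then \<open>G\<close> contains nonscalar matrices \<open>I + \<epsilon>\<^sub>n Y\<^sub>n\<close> with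
  \<open>\<epsilon>\<^sub>n \<down> 0\<close> and \<open>Y\<^sub>n\<close> converging to a traceless \<open>X \<noteq> 0\<close>; the powers of these matrices approximate the
  one-parameter semigroup \<open>exp (t X)\<close>, \<open>t \<ge> 0\<close>, which is therefore contained in \<open>G\<close>.

  If \<open>X\<close> is elliptic, \<open>G\<close> contains a full rotation group, and any element that does not commute with it
  generates everything together with it. If \<open>X\<close> is hyperbolic or parabolic, let \<open>\<Sigma>\<close> be the orbit under
  \<open>G\<close> of the attracting fixed point, written in the affine chart given by the slope of a vector. The flow
  makes \<open>\<Sigma>\<close> an interval. If \<open>\<Sigma>\<close> is trivial, there is a finite orbit; if it is bounded on one side, its
  closure is an invariant interval; and if it is the whole line, suitable products \<open>exp (s X) h exp (t X) k\<close>
  have a trace that changes sign with \<open>s\<close>. In the last case some of them are rotations by an irrational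
  angle, and the elliptic case applies.
\<close>

section \<open>Two-by-two matrices\<close>

text \<open>The obstacle throughout is that \<open>S\<close> has no inverses, so a tangent direction
  yields its flow only for times \<open>t \<ge> 0\<close>. Inverses come back only through elliptic
  elements: the forward powers of an irrational rotation are dense in the whole rotation group about
  its fixed point. This is why the hyperbolic and parabolic cases aim at an elliptic product,
  recognised at determinant 1 by a trace of absolute value below 2. A sign change of the trace along
  a continuous path is enough: the trace then takes a whole interval of values
  \<open>2 * cos \<theta>\<close>, and some of these angles are irrational. Producing the sign
  change requires a factor whose first column has a prescribed (or sufficiently large) ratio of
  entries, or the same for its second column, and this is what an unbounded \<open>\<Sigma>\<close>
  supplies. Matrices are used up to nonzero scalars of either sign instead of at determinant 1. Each
  step can then choose its own normalisation: half the trace near the identity, the determinant when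
  angles are read off, one entry when neighbourhoods are described.\<close>

definition mat2 :: "real \<Rightarrow> real \<Rightarrow> real \<Rightarrow> real \<Rightarrow> real^2^2" where
  "mat2 a b c d = vector [vector [a, b], vector [c, d]]"

definition vec2 :: "real \<Rightarrow> real \<Rightarrow> real^2" where
  "vec2 x y = vector [x, y]"

lemma mat2_nth [simp]:
  "mat2 a b c d $ 1 $ 1 = a" "mat2 a b c d $ 1 $ 2 = b"
  "mat2 a b c d $ 2 $ 1 = c" "mat2 a b c d $ 2 $ 2 = d"
  by (simp_all add: mat2_def)

lemma vec2_nth [simp]: "vec2 x y $ 1 = x" "vec2 x y $ 2 = y"
  by (simp_all add: vec2_def)

lemma mat2_eta [simp]: "mat2 (A $ 1 $ 1) (A $ 1 $ 2) (A $ 2 $ 1) (A $ 2 $ 2) = A"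
  by (simp add: vec_eq_iff forall_2)

lemma mat2_cases: obtains a b c d where "A = mat2 a b c d"
  by (metis mat2_eta)

lemma vec2_cases: obtains x y where "v = vec2 x y"
proof -
  have "v = vec2 (v $ 1) (v $ 2)" by (simp add: vec_eq_iff forall_2)
  then show thesis by (rule that)
qed

lemma mat2_eq_iff [simp]:
  "mat2 a b c d = mat2 a' b' c' d' \<longleftrightarrow> a = a' \<and> b = b' \<and> c = c' \<and> d = d'"
  by (auto simp: vec_eq_iff forall_2)

lemma vec2_eq_0_iff [simp]: "vec2 x y = 0 \<longleftrightarrow> x = 0 \<and> y = 0"
  by (auto simp: vec_eq_iff forall_2)

lemma mat2_mult [simp]:
  "mat2 a b c d ** mat2 a' b' c' d' = mat2 (a*a' + b*c') (a*b' + b*d') (c*a' + d*c') (c*b' + d*d')"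
  by (simp add: vec_eq_iff forall_2 matrix_matrix_mult_def sum_2)

lemma mat2_mult_vec2 [simp]: "mat2 a b c d *v vec2 x y = vec2 (a*x + b*y) (c*x + d*y)"
  by (simp add: vec_eq_iff forall_2 matrix_vector_mult_def sum_2)

lemma mat2_add [simp]: "mat2 a b c d + mat2 a' b' c' d' = mat2 (a+a') (b+b') (c+c') (d+d')"
  and mat2_scaleR [simp]: "r *\<^sub>R mat2 a b c d = mat2 (r*a) (r*b) (r*c) (r*d)"
  and vec2_scaleR [simp]: "r *\<^sub>R vec2 x y = vec2 (r*x) (r*y)"
  by (simp_all add: vec_eq_iff forall_2)

lemma det_mat2 [simp]: "det (mat2 a b c d) = a*d - b*c"
  by (simp add: det_2)

lemma mat_1_mat2: "mat 1 = mat2 1 0 0 1"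
  by (simp add: vec_eq_iff forall_2 mat_def)

lemma tendsto_mat2:
  assumes "(a \<longlongrightarrow> a') F" "(b \<longlongrightarrow> b') F" "(c \<longlongrightarrow> c') F" "(d \<longlongrightarrow> d') F"
  shows "((\<lambda>n. mat2 (a n) (b n) (c n) (d n)) \<longlongrightarrow> mat2 a' b' c' d') F"
proof (intro vec_tendstoI)
  fix i j
  have "\<forall>i j. ((\<lambda>n. mat2 (a n) (b n) (c n) (d n) $ i $ j) \<longlongrightarrow> mat2 a' b' c' d' $ i $ j) F"
    by (simp add: forall_2 assms)
  then show "((\<lambda>n. mat2 (a n) (b n) (c n) (d n) $ i $ j) \<longlongrightarrow> mat2 a' b' c' d' $ i $ j) F"
    by blast
qed

text \<open>The operator norm for the maximum norm: submultiplicative, and equal to 1 at the identity.\<close>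

definition row_norm :: "real^2^2 \<Rightarrow> real" where
  "row_norm A = max (\<bar>A $ 1 $ 1\<bar> + \<bar>A $ 1 $ 2\<bar>) (\<bar>A $ 2 $ 1\<bar> + \<bar>A $ 2 $ 2\<bar>)"

lemma row_norm_le_iff:
  "row_norm A \<le> c \<longleftrightarrow> (\<forall>i. \<bar>A $ i $ 1\<bar> + \<bar>A $ i $ 2\<bar> \<le> c)"
  by (simp add: row_norm_def forall_2)

lemma row_le_row_norm: "\<bar>A $ i $ 1\<bar> + \<bar>A $ i $ 2\<bar> \<le> row_norm A"
  using row_norm_le_iff by blast

lemma row_norm_nonneg: "0 \<le> row_norm A"
  by (rule order_trans[OF _ row_le_row_norm[of A 1]]) simp

lemma row_norm_mult: "row_norm (A ** B) \<le> row_norm A * row_norm B"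
proof (unfold row_norm_le_iff, intro allI)
  fix i
  have eq: "(A ** B) $ i $ j = A $ i $ 1 * B $ 1 $ j + A $ i $ 2 * B $ 2 $ j" for j
    by (simp add: matrix_matrix_mult_def sum_2)
  have "\<bar>(A ** B) $ i $ 1\<bar> + \<bar>(A ** B) $ i $ 2\<bar>
      \<le> (\<bar>A $ i $ 1 * B $ 1 $ 1\<bar> + \<bar>A $ i $ 2 * B $ 2 $ 1\<bar>)
       + (\<bar>A $ i $ 1 * B $ 1 $ 2\<bar> + \<bar>A $ i $ 2 * B $ 2 $ 2\<bar>)"
    unfolding eq by (intro add_mono abs_triangle_ineq)
  also have "\<dots> = \<bar>A $ i $ 1\<bar> * (\<bar>B $ 1 $ 1\<bar> + \<bar>B $ 1 $ 2\<bar>) + \<bar>A $ i $ 2\<bar> * (\<bar>B $ 2 $ 1\<bar> + \<bar>B $ 2 $ 2\<bar>)"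
    unfolding abs_mult by (simp only: algebra_simps)
  also have "\<dots> \<le> \<bar>A $ i $ 1\<bar> * row_norm B + \<bar>A $ i $ 2\<bar> * row_norm B"
    by (intro add_mono mult_left_mono row_le_row_norm abs_ge_zero)
  also have "\<dots> \<le> row_norm A * row_norm B"
    unfolding distrib_right[symmetric] by (intro mult_right_mono row_le_row_norm row_norm_nonneg)
  finally show "\<bar>(A ** B) $ i $ 1\<bar> + \<bar>(A ** B) $ i $ 2\<bar> \<le> row_norm A * row_norm B" .
qed

lemma row_norm_triangle: "row_norm (A + B) \<le> row_norm A + row_norm B"
proof (unfold row_norm_le_iff, intro allI)
  fix i
  have "\<bar>(A + B) $ i $ 1\<bar> + \<bar>(A + B) $ i $ 2\<bar>
      \<le> (\<bar>A $ i $ 1\<bar> + \<bar>B $ i $ 1\<bar>) + (\<bar>A $ i $ 2\<bar> + \<bar>B $ i $ 2\<bar>)"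
    unfolding vector_add_component by (intro add_mono abs_triangle_ineq)
  also have "\<dots> = (\<bar>A $ i $ 1\<bar> + \<bar>A $ i $ 2\<bar>) + (\<bar>B $ i $ 1\<bar> + \<bar>B $ i $ 2\<bar>)"
    by (simp only: ac_simps)
  also have "\<dots> \<le> row_norm A + row_norm B"
    by (intro add_mono row_le_row_norm)
  finally show "\<bar>(A + B) $ i $ 1\<bar> + \<bar>(A + B) $ i $ 2\<bar> \<le> row_norm A + row_norm B" .
qed

lemma row_norm_scaleR: "row_norm (r *\<^sub>R A) = \<bar>r\<bar> * row_norm A"
proof -
  have "\<bar>r\<bar> * max x y = max (\<bar>r\<bar> * x) (\<bar>r\<bar> * y)" for x y :: real
    by (simp add: max_mult_distrib_left)
  then show ?thesis
    by (simp only: row_norm_def vector_scaleR_component real_scaleR_def abs_mult distrib_left)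
qed

lemma row_norm_0: "row_norm 0 = 0"
  by (simp add: row_norm_def)

lemma row_norm_1: "row_norm (mat 1) = 1"
  by (simp add: row_norm_def mat_1_mat2)

lemma abs_le_row_norm: "\<bar>A $ i $ j\<bar> \<le> row_norm A"
proof -
  have "\<forall>j. \<bar>A $ i $ j\<bar> \<le> \<bar>A $ i $ 1\<bar> + \<bar>A $ i $ 2\<bar>" by (simp add: forall_2)
  then show ?thesis using row_le_row_norm order_trans by blast
qed

lemma tendsto_row_norm:
  assumes "(A \<longlongrightarrow> B) F" shows "((\<lambda>n. row_norm (A n)) \<longlongrightarrow> row_norm B) F"
  unfolding row_norm_def by (intro tendsto_intros assms)

lemma Bseq_row_norm:
  assumes "A \<longlonglongrightarrow> B" shows "\<exists>C. \<forall>n. row_norm (A n) \<le> C"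
proof -
  have "Bseq (\<lambda>n. row_norm (A n))"
    using tendsto_row_norm[OF assms] by (intro convergent_imp_Bseq) (auto simp: convergent_def)
  then show ?thesis by (auto simp: Bseq_def abs_le_iff)
qed

lemma tendsto_row_normI:
  assumes "((\<lambda>n. row_norm (A n - B)) \<longlongrightarrow> 0) F" shows "(A \<longlongrightarrow> B) F"
proof (intro vec_tendstoI)
  fix i j
  show "((\<lambda>n. A n $ i $ j) \<longlongrightarrow> B $ i $ j) F"
  proof (rule LIM_zero_cancel, rule Lim_null_comparison[OF _ assms])
    show "\<forall>\<^sub>F n in F. norm (A n $ i $ j - B $ i $ j) \<le> row_norm (A n - B)"
      using abs_le_row_norm[of "_ - B" i j] by simp
  qed
qed

section \<open>Powers of matrices and their perturbation\<close>

primrec mat_pow :: "real^2^2 \<Rightarrow> nat \<Rightarrow> real^2^2" where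
  "mat_pow A 0 = mat 1"
| "mat_pow A (Suc n) = A ** mat_pow A n"

lemma row_norm_mat_pow: "row_norm (mat_pow A n) \<le> row_norm A ^ n"
proof (induction n)
  case (Suc n)
  have "row_norm (A ** mat_pow A n) \<le> row_norm A * row_norm (mat_pow A n)" by (rule row_norm_mult)
  also have "\<dots> \<le> row_norm A * row_norm A ^ n" by (intro mult_left_mono Suc row_norm_nonneg)
  finally show ?case by simp
qed (simp add: row_norm_1)

text \<open>Telescoping, one factor at a time:
  \<open>A^(n+1) - B^(n+1) = A (A^n - B^n) + (A - B) B^n\<close>. The exponent \<open>n\<close> in
  place of \<open>n - 1\<close> is not sharp but keeps subtraction out of the induction.\<close>

lemma row_norm_mat_pow_diff:
  assumes "row_norm A \<le> K" "row_norm B \<le> K" "1 \<le> K"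
  shows "row_norm (mat_pow A n - mat_pow B n) \<le> of_nat n * K ^ n * row_norm (A - B)"
proof (induction n)
  case 0
  show ?case by (simp add: row_norm_0)
next
  case (Suc n)
  have "mat_pow A (Suc n) - mat_pow B (Suc n) = A ** (mat_pow A n - mat_pow B n) + (A - B) ** mat_pow B n"
    by (simp add: matrix_matrix_mult_def vec_eq_iff sum_2 algebra_simps)
  then have "row_norm (mat_pow A (Suc n) - mat_pow B (Suc n)) \<le>
      row_norm A * row_norm (mat_pow A n - mat_pow B n) + row_norm (A - B) * row_norm (mat_pow B n)"
    by (simp only:) (intro order_trans[OF row_norm_triangle] add_mono row_norm_mult)
  also have "\<dots> \<le> K * (of_nat n * K ^ n * row_norm (A - B)) + row_norm (A - B) * K ^ Suc n"
  proof (intro add_mono mult_mono Suc)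
    have "row_norm (mat_pow B n) \<le> K ^ n"
      using row_norm_mat_pow[of B n] power_mono[OF assms(2) row_norm_nonneg, of n] by linarith
    also have "\<dots> \<le> K ^ Suc n" using assms(3) by (intro power_increasing) auto
    finally show "row_norm (mat_pow B n) \<le> K ^ Suc n" .
  qed (use assms row_norm_nonneg in simp_all)
  also have "\<dots> = of_nat (Suc n) * K ^ Suc n * row_norm (A - B)" by (simp add: algebra_simps)
  finally show ?case .
qed

section \<open>Closed matrix semigroups and one-parameter flows\<close>

text \<open>Scalars of both signs are allowed because a transformation does not determine the sign
  of its matrix. Closedness is relative to positive determinant because limits of such matrices can
  be singular.\<close>

locale matrix_semigroup =
  fixes G :: "(real^2^2) set"
  assumes one: "mat 1 \<in> G"
    and det_pos: "A \<in> G \<Longrightarrow> det A > 0"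
    and mult: "A \<in> G \<Longrightarrow> B \<in> G \<Longrightarrow> A ** B \<in> G"
    and scale: "A \<in> G \<Longrightarrow> c \<noteq> 0 \<Longrightarrow> c *\<^sub>R A \<in> G"
    and closure: "A \<in> closure G \<Longrightarrow> det A > 0 \<Longrightarrow> A \<in> G"
begin

lemma limit:
  fixes A :: "nat \<Rightarrow> real^2^2"
  assumes "A \<longlonglongrightarrow> B" "\<And>n. A n \<in> G" "det B > 0"
  shows "B \<in> G"
  using assms by (intro closure) (auto simp: closure_sequential)

lemma mat_pow_mem: "A \<in> G \<Longrightarrow> mat_pow A n \<in> G"
  by (induction n) (auto simp: one mult)

text \<open>
  The product formula \<open>(I + \<epsilon>\<^sub>n Y\<^sub>n)\<^sup>m \<longrightarrow> exp (t X)\<close> for \<open>m = \<lfloor>t / \<epsilon>\<^sub>n\<rfloor>\<close>, obtained by telescoping against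
  \<open>F \<epsilon>\<^sub>n ^ m\<close>.
\<close>

lemma flow:
  fixes F :: "real \<Rightarrow> real^2^2"
  assumes F0: "F 0 = mat 1" and Fadd: "\<And>s t. F (s + t) = F s ** F t"
    and Flim: "((\<lambda>h. (1 / h) *\<^sub>R (F h - mat 1)) \<longlongrightarrow> X) (at_right 0)"
    and Fcont: "continuous_on UNIV F" and Fdet: "det (F t) > 0" and t: "t \<ge> 0"
    and eps: "\<And>n::nat. \<epsilon> n > 0" "\<epsilon> \<longlonglongrightarrow> 0" and Y: "Y \<longlonglongrightarrow> X"
    and inG: "\<And>n. mat 1 + \<epsilon> n *\<^sub>R Y n \<in> G"
  shows "F t \<in> G"
proof -
  define Z where "Z n = (1 / \<epsilon> n) *\<^sub>R (F (\<epsilon> n) - mat 1)" for n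
  define m where "m n = nat \<lfloor>t / \<epsilon> n\<rfloor>" for n
  have "filterlim \<epsilon> (at_right 0) sequentially"
    by (rule tendsto_imp_filterlim_at_right[OF eps(2)]) (simp add: eps(1) always_eventually)
  then have Z: "Z \<longlonglongrightarrow> X" unfolding Z_def by (rule filterlim_compose[OF Flim])
  have FZ: "F (\<epsilon> n) = mat 1 + \<epsilon> n *\<^sub>R Z n" for n
    using eps(1)[of n] by (simp add: Z_def)
  obtain C1 where C1: "\<And>n. row_norm (Y n) \<le> C1"
    using Bseq_row_norm[OF Y] by blast
  obtain C2 where C2: "\<And>n. row_norm (Z n) \<le> C2"
    using Bseq_row_norm[OF Z] by blast
  define C where "C = max C1 C2"
  have C: "row_norm (Y n) \<le> C" "row_norm (Z n) \<le> C" "C \<ge> 0" for n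
    using C1[of n] C2[of n] row_norm_nonneg[of "Y n"] by (auto simp: C_def)
  \<comment> \<open>An exponential bound, so that its \<open>m n\<close>-th power is
    \<open>exp (m n * \<epsilon> n * C)\<close>, which is at most \<open>exp (t * C)\<close> for
    every \<open>n\<close>.\<close>
  have le: "row_norm (mat 1 + \<epsilon> n *\<^sub>R W) \<le> exp (\<epsilon> n * C)" if "row_norm W \<le> C" for n W
  proof -
    have "row_norm (mat 1 + \<epsilon> n *\<^sub>R W) \<le> 1 + \<epsilon> n * row_norm W"
      using row_norm_triangle[of "mat 1" "\<epsilon> n *\<^sub>R W"] eps(1)[of n] by (simp add: row_norm_1 row_norm_scaleR)
    also have "\<dots> \<le> 1 + \<epsilon> n * C" using that eps(1)[of n] by simp
    also have "\<dots> \<le> exp (\<epsilon> n * C)" by (rule exp_ge_add_one_self)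
    finally show ?thesis .
  qed
  have pow: "mat_pow (F e) k = F (real k * e)" for e k
    by (induction k) (simp_all add: F0 Fadd[symmetric] algebra_simps)
  have m_le: "real (m n) * \<epsilon> n \<le> t" for n
  proof -
    have "real (m n) \<le> t / \<epsilon> n" using eps(1)[of n] t by (simp add: m_def)
    then show ?thesis using eps(1)[of n] by (simp add: field_simps)
  qed
  have m_ge: "t - \<epsilon> n \<le> real (m n) * \<epsilon> n" for n
  proof -
    have "t / \<epsilon> n \<le> real (m n) + 1" using eps(1)[of n] t by (simp add: m_def)
    then show ?thesis using eps(1)[of n] by (simp add: field_simps)
  qed
  \<comment> \<open>Each of the \<open>m n\<close> factors contributes an error of order
    \<open>\<epsilon> n\<close> times the distance of \<open>Y n\<close> and \<open>Z n\<close>.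
    Since \<open>m n * \<epsilon> n \<le> t\<close>, the total is controlled by that distance, which
    vanishes because both sequences tend to \<open>X\<close>.\<close>
  have bound: "row_norm (mat_pow (mat 1 + \<epsilon> n *\<^sub>R Y n) (m n) - F (real (m n) * \<epsilon> n)) \<le> t * exp (t * C) * row_norm (Y n - Z n)" for n
  proof -
    have "row_norm (mat_pow (mat 1 + \<epsilon> n *\<^sub>R Y n) (m n) - mat_pow (F (\<epsilon> n)) (m n))
       \<le> of_nat (m n) * exp (\<epsilon> n * C) ^ m n * row_norm ((mat 1 + \<epsilon> n *\<^sub>R Y n) - F (\<epsilon> n))"
      unfolding FZ using eps(1)[of n] C by (intro row_norm_mat_pow_diff le) auto
    also have "\<dots> = of_nat (m n) * exp (\<epsilon> n * C) ^ m n * row_norm (\<epsilon> n *\<^sub>R (Y n - Z n))"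
      by (simp add: FZ scaleR_diff_right)
    also have "\<dots> = (real (m n) * \<epsilon> n) * exp ((real (m n) * \<epsilon> n) * C) * row_norm (Y n - Z n)"
      using eps(1)[of n] by (simp add: row_norm_scaleR exp_of_nat_mult[symmetric] ac_simps)
    also have "\<dots> \<le> t * exp (t * C) * row_norm (Y n - Z n)"
      using m_le[of n] t C(3) eps(1)[of n] by (intro mult_mono mult_right_mono row_norm_nonneg) (simp_all add: mult_right_mono)
    finally show ?thesis by (simp add: pow)
  qed
  have "(\<lambda>n. real (m n) * \<epsilon> n) \<longlonglongrightarrow> t"
  proof (rule tendsto_sandwich)
    show "(\<lambda>n. t - \<epsilon> n) \<longlonglongrightarrow> t" using tendsto_diff[OF tendsto_const eps(2), of t] by simp
    show "(\<lambda>n. t) \<longlonglongrightarrow> t" by (rule tendsto_const)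
  qed (simp_all add: m_le m_ge)
  then have Ft: "(\<lambda>n. F (real (m n) * \<epsilon> n)) \<longlonglongrightarrow> F t"
    by (intro continuous_on_tendsto_compose[OF Fcont]) simp_all
  have "(\<lambda>n. row_norm (Y n - Z n)) \<longlonglongrightarrow> row_norm (X - X)"
    by (intro tendsto_row_norm tendsto_diff Y Z)
  then have "(\<lambda>n. t * exp (t * C) * row_norm (Y n - Z n)) \<longlonglongrightarrow> 0"
    by (intro tendsto_mult_right_zero) (simp add: row_norm_0)
  then have "(\<lambda>n. row_norm ((mat_pow (mat 1 + \<epsilon> n *\<^sub>R Y n) (m n) - F (real (m n) * \<epsilon> n)) - 0)) \<longlonglongrightarrow> 0"
    by (rule Lim_null_comparison[rotated]) (simp add: bound row_norm_nonneg)
  then have "(\<lambda>n. mat_pow (mat 1 + \<epsilon> n *\<^sub>R Y n) (m n) - F (real (m n) * \<epsilon> n)) \<longlonglongrightarrow> 0"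
    by (rule tendsto_row_normI[where B = 0])
  from tendsto_add[OF this Ft] have "(\<lambda>n. mat_pow (mat 1 + \<epsilon> n *\<^sub>R Y n) (m n)) \<longlonglongrightarrow> F t"
    by (simp only: diff_add_cancel add_0)
  then show ?thesis 
  proof (rule limit)
    show "mat_pow (mat 1 + \<epsilon> n *\<^sub>R Y n) (m n) \<in> G" for n by (rule mat_pow_mem, rule inG)
  qed (rule Fdet)
qed

end

section \<open>Semigroups containing all rotations\<close>

text \<open>The real matrix of the map \<open>z \<mapsto> \<alpha> z + \<beta> cnj z\<close>.\<close>

definition cmat :: "complex \<Rightarrow> complex \<Rightarrow> real^2^2" where
  "cmat \<alpha> \<beta> = mat2 (Re \<alpha> + Re \<beta>) (Im \<beta> - Im \<alpha>) (Im \<alpha> + Im \<beta>) (Re \<alpha> - Re \<beta>)"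

lemma cmat_cases: obtains \<alpha> \<beta> where "A = cmat \<alpha> \<beta>"
proof -
  obtain a b c d where A: "A = mat2 a b c d" by (rule mat2_cases)
  have "A = cmat (Complex ((a + d) / 2) ((c - b) / 2)) (Complex ((a - d) / 2) ((c + b) / 2))"
    by (simp add: A cmat_def field_simps)
  then show thesis by (rule that)
qed

lemma cmat_mult: "cmat \<alpha> \<beta> ** cmat \<gamma> \<delta> = cmat (\<alpha> * \<gamma> + \<beta> * cnj \<delta>) (\<alpha> * \<delta> + \<beta> * cnj \<gamma>)"
  by (simp add: cmat_def algebra_simps)

lemma cmat_scaleR: "r *\<^sub>R cmat \<alpha> \<beta> = cmat (of_real r * \<alpha>) (of_real r * \<beta>)"
  by (simp add: cmat_def algebra_simps)

lemma det_cmat: "det (cmat \<alpha> \<beta>) = (cmod \<alpha>)\<^sup>2 - (cmod \<beta>)\<^sup>2"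
  unfolding cmod_power2 by (simp add: cmat_def power2_eq_square algebra_simps)

lemma tendsto_cmat:
  assumes "(f \<longlongrightarrow> \<alpha>) F" "(g \<longlongrightarrow> \<beta>) F"
  shows "((\<lambda>n. cmat (f n) (g n)) \<longlongrightarrow> cmat \<alpha> \<beta>) F"
  unfolding cmat_def by (intro tendsto_mat2 tendsto_intros assms)

lemma exists_cis_factor:
  assumes "cmod w = r * cmod z" "r > 0"
  shows "\<exists>b. w = of_real r * cis b * z"
proof (cases "z = 0")
  case True then show ?thesis using assms by simp
next
  case False
  have "cmod (w / z) = r" using False assms by (simp add: norm_divide)
  then have "w / z = of_real r * cis (Arg (w / z))" using rcis_cmod_Arg[of "w / z"] by (simp add: rcis_def)
  then have "w = of_real r * cis (Arg (w / z)) * z" using False by (metis nonzero_divide_eq_eq)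
  then show ?thesis by blast
qed

text \<open>A matrix and its negative give the same transformation, so nonnegativity can only be
  asked up to a common sign.\<close>

definition same_sign :: "real^2^2 \<Rightarrow> bool" where
  "same_sign M \<longleftrightarrow> (\<forall>i j. M $ i $ j \<ge> 0) \<or> (\<forall>i j. M $ i $ j \<le> 0)"

text \<open>
  The matrix forms of the conclusions: the point of the circle given by \<open>v\<close> has its orbit among those
  given by \<open>v\<close> and \<open>w\<close>; the fixed point of \<open>X\<close> in the upper half-plane is fixed by \<open>G\<close>; the interval
  given by the image under \<open>Q\<close> of the closed positive quadrant is mapped into itself.
\<close>

definition finite_real_orbit :: "(real^2^2) set \<Rightarrow> bool" where
  "finite_real_orbit G \<longleftrightarrow>
    (\<exists>v w. v \<noteq> 0 \<and> w \<noteq> 0 \<and> (\<forall>A\<in>G. \<exists>c. A *v v = c *\<^sub>R v \<or> A *v v = c *\<^sub>R w))"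

definition commutes_with_rotation :: "(real^2^2) set \<Rightarrow> bool" where
  "commutes_with_rotation G \<longleftrightarrow> (\<exists>X. X ** X = - mat 1 \<and> (\<forall>A\<in>G. A ** X = X ** A))"

definition preserves_cone :: "(real^2^2) set \<Rightarrow> bool" where
  "preserves_cone G \<longleftrightarrow> (\<exists>R Q. R ** Q = mat 1 \<and> (\<forall>A\<in>G. same_sign (R ** A ** Q)))"

definition alternatives :: "(real^2^2) set \<Rightarrow> bool" where
  "alternatives G \<longleftrightarrow> finite_real_orbit G \<or> commutes_with_rotation G \<or> preserves_cone G \<or> G = {A. det A > 0}"

context matrix_semigroup
begin

text \<open>A rotation on the left turns \<open>\<alpha>\<close> and \<open>\<beta>\<close> by the
  same angle, one on the right turns them by opposite angles. Half the sum and half the difference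
  of the required angles therefore turn the two independently, and a scalar adjusts the
  moduli.\<close>

lemma cmat_transfer:
  assumes rot: "\<And>\<theta>. cmat (cis \<theta>) 0 \<in> G" and G: "cmat \<alpha> \<beta> \<in> G"
    and nz: "\<alpha>' \<noteq> 0" and eq: "cmod \<beta>' * cmod \<alpha> = cmod \<beta> * cmod \<alpha>'"
  shows "cmat \<alpha>' \<beta>' \<in> G"
proof -
  have "(cmod \<beta>)\<^sup>2 < (cmod \<alpha>)\<^sup>2" using det_pos[OF G] by (simp add: det_cmat)
  then have a: "\<alpha> \<noteq> 0" by (auto simp: not_less)
  define r where "r = cmod \<alpha>' / cmod \<alpha>"
  have r: "r > 0" "cmod \<alpha>' = r * cmod \<alpha>" "cmod \<beta>' = r * cmod \<beta>"
    using a nz eq by (simp_all add: r_def field_simps)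
  from exists_cis_factor[OF r(2,1)] obtain a where a: "\<alpha>' = of_real r * cis a * \<alpha>" by blast
  from exists_cis_factor[OF r(3,1)] obtain b where b: "\<beta>' = of_real r * cis b * \<beta>" by blast
  have "r *\<^sub>R (cmat (cis ((a + b) / 2)) 0 ** cmat \<alpha> \<beta> ** cmat (cis ((a - b) / 2)) 0) \<in> G"
    using r by (intro scale mult rot G) simp
  moreover have "cis ((a + b) / 2) * cis ((a - b) / 2) = cis a"
    by (simp add: cis_mult field_simps)
  moreover have "cis ((a + b) / 2) * cis (- ((a - b) / 2)) = cis b"
    unfolding cis_mult by (rule arg_cong[where f = cis]) (simp add: field_simps)
  ultimately show ?thesis
    unfolding a b by (simp add: cmat_mult cmat_scaleR cis_cnj mult.assoc mult.left_commute mult.commute)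
qed

text \<open>
  Up to rotations and scaling, \<open>cmat \<alpha> \<beta>\<close> is determined by the ratio \<open>\<bar>\<beta>\<bar> / \<bar>\<alpha>\<bar>\<close>. Inserting a rotation
  between two factors of ratio \<open>\<rho>\<close> yields all ratios from 0 to \<open>2 \<rho> / (1 + \<rho>\<^sup>2)\<close>.
\<close>

lemma rotations_step:
  assumes rot: "\<And>\<theta>. cmat (cis \<theta>) 0 \<in> G" and G: "cmat 1 (of_real \<rho>) \<in> G" and \<rho>: "0 \<le> \<rho>" "\<rho> < 1"
    and t: "0 \<le> t" "t \<le> 2 * \<rho> / (1 + \<rho>\<^sup>2)"
  shows "cmat 1 (of_real t) \<in> G"
proof -
  \<comment> \<open>The ratio of moduli for the product of \<open>cmat 1 \<rho>\<close> and
    \<open>cmat 1 (\<rho> * cis \<theta>)\<close>. It runs continuously from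
    \<open>2 * \<rho> / (1 + \<rho>^2)\<close> at 0 to 0 at \<open>pi\<close>.\<close>
  define f where "f \<theta> = cmod (of_real \<rho> * cis \<theta> + of_real \<rho>) / cmod (1 + of_real (\<rho>\<^sup>2) * cis (- \<theta>))" for \<theta>
  have \<rho>2: "\<rho>\<^sup>2 < 1" using \<rho> by (simp add: abs_square_less_1)
  have nz: "1 + of_real (\<rho>\<^sup>2) * cis (- \<theta>) \<noteq> 0" for \<theta>
  proof
    assume "1 + of_real (\<rho>\<^sup>2) * cis (- \<theta>) = 0"
    then have "of_real (\<rho>\<^sup>2) * cis (- \<theta>) = - 1" by (simp add: eq_neg_iff_add_eq_0 add.commute)
    then have "cmod (of_real (\<rho>\<^sup>2) * cis (- \<theta>)) = 1" by simp
    then show False using \<rho>2 by (simp add: norm_mult norm_power)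
  qed
  have "continuous_on {0..pi} f"
    unfolding f_def by (intro continuous_intros) (use nz in auto)
  moreover have "f pi = 0" by (simp add: f_def)
  moreover have "f 0 = 2 * \<rho> / (1 + \<rho>\<^sup>2)"
  proof -
    have "cmod (1 + of_real (\<rho>\<^sup>2)) = 1 + \<rho>\<^sup>2"
      by (metis abs_of_nonneg add_nonneg_nonneg norm_of_real of_real_1 of_real_add zero_le_one zero_le_power2)
    moreover have "cmod (of_real \<rho> + of_real \<rho>) = 2 * \<rho>"
      using \<rho> by (metis abs_of_nonneg add_nonneg_nonneg mult_2 norm_of_real of_real_add)
    ultimately show ?thesis by (simp add: f_def)
  qed
  ultimately obtain \<theta> where \<theta>: "f \<theta> = t"
    using IVT2'[of f pi t 0] t by auto
  have "cmat 1 (of_real \<rho> * cis \<theta>) \<in> G"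
    by (rule cmat_transfer[OF rot G]) (simp_all add: norm_mult)
  from mult[OF G this] have P: "cmat (1 + of_real (\<rho>\<^sup>2) * cis (- \<theta>)) (of_real \<rho> * cis \<theta> + of_real \<rho>) \<in> G"
    by (simp add: cmat_mult cis_cnj power2_eq_square mult.assoc)
  show ?thesis
    by (rule cmat_transfer[OF rot P]) (use \<theta> t nz[of \<theta>] in \<open>simp_all add: f_def field_simps\<close>)
qed

text \<open>If \<open>\<beta>\<close> always vanishes, everything commutes with the right angle
  rotation. Otherwise the attainable ratios form an interval starting at 0. If its supremum
  \<open>s\<close> were below 1, closedness would make \<open>s\<close> itself attainable, and one
  more step would attain \<open>2 * s / (1 + s^2) > s\<close>. Ratios below 1 are exactly those of
  positive determinant.\<close>

lemma rotations_imp_alternatives: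
  assumes rot: "\<And>\<theta>. cmat (cis \<theta>) 0 \<in> G"
  shows "alternatives G"
proof (cases "\<forall>\<alpha> \<beta>. cmat \<alpha> \<beta> \<in> G \<longrightarrow> \<beta> = 0")
  case True
  have "A ** cmat \<i> 0 = cmat \<i> 0 ** A" if "A \<in> G" for A
  proof -
    obtain \<alpha> \<beta> where A: "A = cmat \<alpha> \<beta>" by (rule cmat_cases)
    with True that have "\<beta> = 0" by blast
    then show ?thesis by (simp add: A cmat_mult mult.commute)
  qed
  moreover have "cmat \<i> 0 ** cmat \<i> 0 = - mat 1"
    by (simp add: cmat_def mat_1_mat2 vec_eq_iff forall_2)
  ultimately show ?thesis unfolding alternatives_def commutes_with_rotation_def by blast
next
  case False
  then obtain \<alpha> \<beta> where G: "cmat \<alpha> \<beta> \<in> G" and b: "\<beta> \<noteq> 0" by blast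
  have lt: "cmod \<beta> < cmod \<alpha>"
    using det_pos[OF G] power_mono_iff[of "cmod \<alpha>" "cmod \<beta>" 2] by (simp add: det_cmat not_le[symmetric])
  define T where "T = {\<rho>. 0 \<le> \<rho> \<and> \<rho> < 1 \<and> cmat 1 (of_real \<rho>) \<in> G}"
  have ratio: "cmod \<beta> / cmod \<alpha> \<in> T"
  proof -
    have a: "0 < cmod \<alpha>" using lt norm_ge_zero[of \<beta>] by linarith
    have "cmat 1 (of_real (cmod \<beta> / cmod \<alpha>)) \<in> G"
      by (rule cmat_transfer[OF rot G]) (use a in \<open>simp_all add: norm_divide\<close>)
    then show ?thesis using a lt by (simp add: T_def)
  qed
  have down: "t \<in> T" if "\<rho> \<in> T" "0 \<le> t" "t \<le> \<rho>" for t \<rho>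
  proof -
    have \<rho>: "0 \<le> \<rho>" "\<rho> < 1" "cmat 1 (of_real \<rho>) \<in> G" using that by (auto simp: T_def)
    have "\<rho>\<^sup>2 \<le> 1" using \<rho> by (simp add: abs_square_le_1)
    then have "\<rho> * (1 + \<rho>\<^sup>2) \<le> \<rho> * 2" using \<rho> by (intro mult_left_mono) auto
    then have "\<rho> \<le> 2 * \<rho> / (1 + \<rho>\<^sup>2)"
      by (subst pos_le_divide_eq) (auto simp: add_pos_nonneg)
    then show ?thesis using that \<rho> rotations_step[OF rot \<rho>(3,1,2), of t] by (auto simp: T_def)
  qed
  have bdd: "bdd_above T" by (auto simp: T_def bdd_above_def intro!: exI[of _ 1])
  define s where "s = Sup T"
  have s0: "0 < s" using cSup_upper[OF ratio bdd] lt b unfolding s_def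
    by (smt (verit) zero_less_divide_iff zero_less_norm_iff norm_ge_zero)
  have below: "t \<in> T" if t: "0 \<le> t" "t < s" for t
  proof -
    obtain \<rho> where "\<rho> \<in> T" "t < \<rho>" using less_cSupD[of T t] ratio t(2) unfolding s_def by blast
    then show ?thesis using down[of \<rho> t] t by simp
  qed
  have s1: "1 \<le> s"
  proof (rule ccontr)
    assume n: "\<not> 1 \<le> s"
    define a where "a n = s * (1 - inverse (real (Suc n)))" for n
    have alim: "a \<longlonglongrightarrow> s"
      unfolding a_def by (rule tendsto_eq_intros LIMSEQ_inverse_real_of_nat | simp)+
    have aT: "a n \<in> T" for n
      using s0 by (intro below) (auto simp: a_def field_simps)
    have s2: "s\<^sup>2 < 1" using s0 n by (simp add: abs_square_less_1)
    have sG: "cmat 1 (of_real s) \<in> G"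
    proof (rule limit)
      show "(\<lambda>n. cmat 1 (of_real (a n))) \<longlonglongrightarrow> cmat 1 (of_real s)"
        by (intro tendsto_cmat tendsto_intros alim)
      show "cmat 1 (of_real (a n)) \<in> G" for n using aT by (simp add: T_def)
      show "0 < det (cmat 1 (of_real s))" using s2 by (simp add: det_cmat)
    qed
    define t where "t = 2 * s / (1 + s\<^sup>2)"
    have pos: "0 < 1 + s\<^sup>2" by (simp add: add_pos_nonneg)
    have "s * (1 + s\<^sup>2) < s * 2" using s0 s2 by (intro mult_strict_left_mono) auto
    then have ts: "s < t" unfolding t_def using pos by (simp add: pos_less_divide_eq)
    have "0 < (1 - s)\<^sup>2" using n by simp
    then have "2 * s < 1 + s\<^sup>2" by (simp add: power2_diff)
    then have "t < 1" unfolding t_def using pos by (simp add: divide_less_eq_1)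
    moreover have "cmat 1 (of_real t) \<in> G"
      by (rule rotations_step[OF rot sG]) (use s0 n ts t_def in auto)
    ultimately have "t \<in> T" using ts s0 by (simp add: T_def)
    then have "t \<le> s" unfolding s_def by (rule cSup_upper[OF _ bdd])
    with ts show False by simp
  qed
  have "A \<in> G" if "det A > 0" for A
  proof -
    obtain \<alpha> \<beta> where A: "A = cmat \<alpha> \<beta>" by (rule cmat_cases)
    have lt: "cmod \<beta> < cmod \<alpha>"
      using that power_mono_iff[of "cmod \<alpha>" "cmod \<beta>" 2] by (simp add: A det_cmat not_le[symmetric])
    then have "cmod \<beta> / cmod \<alpha> < 1"
      using norm_ge_zero[of \<beta>] by (simp add: divide_less_eq_1)
    then have "cmod \<beta> / cmod \<alpha> \<in> T"
      using s1 by (intro below) auto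
    then have "cmat 1 (of_real (cmod \<beta> / cmod \<alpha>)) \<in> G" by (simp add: T_def)
    then show ?thesis unfolding A
      by (rule cmat_transfer[OF rot]) (use lt in \<open>auto simp: norm_divide\<close>)
  qed
  then have "G = {A. det A > 0}" using det_pos by blast
  then show ?thesis by (simp add: alternatives_def)
qed

end

section \<open>Conjugation and elliptic elements\<close>

text \<open>Such an \<open>X\<close> is a complex structure on the plane. It has no real
  eigenvector, so \<open>vec2 1 0\<close> is not one, which is why \<open>r\<close> cannot
  vanish.\<close>

lemma mat2_square_eq_minus_1:
  assumes "X ** X = - mat 1"
  obtains p q r where "X = mat2 p q r (- p)" "p * p + q * r = - 1" "r \<noteq> 0"
proof -
  obtain p q r s where X: "X = mat2 p q r s" by (rule mat2_cases)
  have m: "- mat 1 = mat2 (-1) 0 0 (-1)" by (simp add: mat_1_mat2 vec_eq_iff forall_2)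
  have eqs: "p*p + q*r = -1" "r*p + s*r = 0" using assms by (simp_all add: X m)
  have "r \<noteq> 0"
  proof
    assume "r = 0" then have "p*p = -1" using eqs by simp
    then show False using zero_le_square[of p] by linarith
  qed
  moreover have "r * (p + s) = 0" using eqs by (simp add: algebra_simps)
  ultimately have "s = - p" by simp
  then show thesis using X eqs \<open>r \<noteq> 0\<close> by (intro that) auto
qed

text \<open>This is \<open>exp (\<theta> X)\<close> when \<open>X ** X = - mat 1\<close>, a
  conjugate of the standard rotation by \<open>\<theta>\<close>.\<close>

definition rotation_about :: "real^2^2 \<Rightarrow> real \<Rightarrow> real^2^2" where
  "rotation_about X \<theta> = cos \<theta> *\<^sub>R mat 1 + sin \<theta> *\<^sub>R X"

lemma det_rotation_about:
  assumes "X ** X = - mat 1" shows "det (rotation_about X \<theta>) = 1"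
proof -
  obtain p q r where X: "X = mat2 p q r (- p)" "p * p + q * r = - 1" by (rule mat2_square_eq_minus_1[OF assms])
  have "det (rotation_about X \<theta>) = (cos \<theta>)\<^sup>2 - (sin \<theta>)\<^sup>2 * (p * p + q * r)"
    by (simp add: rotation_about_def X(1) mat_1_mat2 algebra_simps power2_eq_square)
  then show ?thesis using X(2) sin_cos_squared_add[of \<theta>] by simp
qed

lemma rotation_about_add:
  assumes "X ** X = - mat 1"
  shows "rotation_about X (s + t) = rotation_about X s ** rotation_about X t"
proof -
  obtain p q r where X: "X = mat2 p q r (- p)" "p * p + q * r = - 1" by (rule mat2_square_eq_minus_1[OF assms])
  show ?thesis
    unfolding rotation_about_def X(1) mat_1_mat2 mat2_scaleR mat2_add mat2_mult mat2_eq_iff cos_add sin_add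
    by (intro conjI; (simp add: algebra_simps; fail | use X(2) in algebra))
qed

lemma exists_irrational_between:
  fixes a b :: real assumes "a < b" shows "\<exists>x. a < x \<and> x < b \<and> x \<notin> \<rat>"
proof (rule ccontr)
  assume "\<not> ?thesis"
  then have "{a<..<b} \<subseteq> \<rat>" by auto
  then have "countable {a<..<b}" using countable_rat countable_subset by blast
  then show False using uncountable_open_interval assms by blast
qed

lemma matrix_mul_cancel:
  fixes P Q :: "real^2^2"
  assumes "P ** Q = mat 1" shows "A ** P ** Q = A"
  using assms by (simp add: matrix_mul_assoc[symmetric])

lemma matrix_mul_minus:
  fixes A B :: "real^2^2"
  shows "A ** (- B) = - (A ** B)" "(- A) ** B = - (A ** B)"
  by (simp_all add: matrix_matrix_mult_def vec_eq_iff sum_negf)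

context matrix_semigroup
begin

lemma conjugate:
  assumes PQ: "P ** Q = mat 1"
  shows "matrix_semigroup ((\<lambda>A. P ** A ** Q) ` G)"
proof
  let ?c = "\<lambda>A. P ** A ** Q"
  have QP: "Q ** P = mat 1" using PQ by (simp add: matrix_left_right_inverse)
  have det1: "det P * det Q = 1" using arg_cong[OF PQ, of det] by (simp add: det_mul)
  have det: "det (P ** A ** Q) = det A" "det (Q ** A ** P) = det A" for A
    using det1 by (simp_all add: det_mul mult.left_commute mult.commute)
  note cancel = matrix_mul_assoc PQ QP matrix_mul_cancel[OF PQ] matrix_mul_cancel[OF QP]
  have inv: "Q ** (P ** A ** Q) ** P = A" for A by (simp add: cancel)
  have inv': "P ** (Q ** A ** P) ** Q = A" for A by (simp add: cancel)
  have mult': "(P ** A ** Q) ** (P ** B ** Q) = P ** (A ** B) ** Q" for A B by (simp add: cancel)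
  show "mat 1 \<in> ?c ` G" using imageI[OF one, of ?c] PQ by simp
  show "det A > 0" if "A \<in> ?c ` G" for A using that det det_pos by auto
  show "A ** B \<in> ?c ` G" if "A \<in> ?c ` G" "B \<in> ?c ` G" for A B
    using that mult' mult by auto
  show "c *\<^sub>R A \<in> ?c ` G" if "A \<in> ?c ` G" "c \<noteq> 0" for A c
  proof -
    obtain B where B: "B \<in> G" "A = ?c B" using \<open>A \<in> ?c ` G\<close> by blast
    have "c *\<^sub>R A = ?c (c *\<^sub>R B)"
      by (simp add: B(2) scalar_matrix_assoc matrix_scalar_ac flip: scalar_mult_eq_scaleR)
    then show ?thesis using scale[OF B(1) \<open>c \<noteq> 0\<close>] by blast
  qed
  show "A \<in> ?c ` G" if "A \<in> closure (?c ` G)" "det A > 0" for A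
  proof -
    obtain X where X: "\<And>n. X n \<in> ?c ` G" "X \<longlonglongrightarrow> A"
      using \<open>A \<in> closure (?c ` G)\<close> by (auto simp: closure_sequential)
    have "(\<lambda>n. Q ** X n ** P) \<longlonglongrightarrow> Q ** A ** P"
      unfolding matrix_matrix_mult_def
      by (intro vec_tendstoI) (simp, intro tendsto_intros tendsto_vec_nth X(2))
    moreover have "Q ** X n ** P \<in> G" for n
      using X(1)[of n] inv by auto
    ultimately have "Q ** A ** P \<in> G"
      by (rule limit) (simp add: det \<open>det A > 0\<close>)
    then show ?thesis using imageI[of _ G ?c] inv'[of A] by metis
  qed
qed

text \<open>All four alternatives are independent of the basis, which permits passing to normal
  forms: vectors and cones are pulled back by \<open>Q\<close>, and \<open>X\<close> by
  conjugation.\<close>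

lemma alternatives_conjugate:
  assumes PQ: "P ** Q = mat 1" and alt: "alternatives ((\<lambda>A. P ** A ** Q) ` G)"
  shows "alternatives G"
proof -
  have QP: "Q ** P = mat 1" using PQ by (simp add: matrix_left_right_inverse)
  have det1: "det P * det Q = 1" using arg_cong[OF PQ, of det] by (simp add: det_mul)
  note cancel = matrix_mul_assoc PQ QP matrix_mul_cancel[OF PQ] matrix_mul_cancel[OF QP]
  have nz: "Q *v v \<noteq> 0" if "v \<noteq> 0" for v
  proof
    assume "Q *v v = 0"
    then have "P *v (Q *v v) = 0" by simp
    then show False using that PQ by (simp add: matrix_vector_mul_assoc)
  qed
  from alt consider "finite_real_orbit ((\<lambda>A. P ** A ** Q) ` G)"
    | "commutes_with_rotation ((\<lambda>A. P ** A ** Q) ` G)"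
    | "preserves_cone ((\<lambda>A. P ** A ** Q) ` G)" | "(\<lambda>A. P ** A ** Q) ` G = {A. det A > 0}"
    unfolding alternatives_def by blast
  then show ?thesis
  proof cases
    case 1
    then obtain v w where v: "v \<noteq> 0" "w \<noteq> 0"
      and orb: "\<And>A. A \<in> G \<Longrightarrow> \<exists>c. (P ** A ** Q) *v v = c *\<^sub>R v \<or> (P ** A ** Q) *v v = c *\<^sub>R w"
      unfolding finite_real_orbit_def by auto
    have "\<exists>c. A *v (Q *v v) = c *\<^sub>R (Q *v v) \<or> A *v (Q *v v) = c *\<^sub>R (Q *v w)" if A: "A \<in> G" for A
    proof -
      have "Q *v ((P ** A ** Q) *v v) = A *v (Q *v v)"
        by (simp add: matrix_vector_mul_assoc cancel)
      moreover obtain c where "(P ** A ** Q) *v v = c *\<^sub>R v \<or> (P ** A ** Q) *v v = c *\<^sub>R w" using orb[OF A] by blast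
      ultimately have "A *v (Q *v v) = c *\<^sub>R (Q *v v) \<or> A *v (Q *v v) = c *\<^sub>R (Q *v w)"
        by (metis matrix_vector_mult_scaleR)
      then show ?thesis by blast
    qed
    then have "finite_real_orbit G" unfolding finite_real_orbit_def using nz v by blast
    then show ?thesis by (simp add: alternatives_def)
  next
    case 2
    then obtain X where X: "X ** X = - mat 1"
      and com: "\<And>A. A \<in> G \<Longrightarrow> (P ** A ** Q) ** X = X ** (P ** A ** Q)"
      unfolding commutes_with_rotation_def by auto
    have "(Q ** X ** P) ** (Q ** X ** P) = Q ** (X ** X) ** P"
      by (simp add: cancel)
    also have "\<dots> = - mat 1"
      using QP unfolding X by (simp add: matrix_mul_minus)
    finally have "(Q ** X ** P) ** (Q ** X ** P) = - mat 1" .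
    moreover have "A ** (Q ** X ** P) = (Q ** X ** P) ** A" if A: "A \<in> G" for A
    proof -
      have "Q ** ((P ** A ** Q) ** X) ** P = Q ** (X ** (P ** A ** Q)) ** P" by (simp add: com[OF A])
      then show ?thesis by (simp add: cancel)
    qed
    ultimately have "commutes_with_rotation G" unfolding commutes_with_rotation_def by blast
    then show ?thesis by (simp add: alternatives_def)
  next
    case 3
    then obtain R S where RS: "R ** S = mat 1"
      and sgn: "\<And>A. A \<in> G \<Longrightarrow> same_sign (R ** (P ** A ** Q) ** S)"
      unfolding preserves_cone_def by auto
    have "(R ** P) ** (Q ** S) = mat 1"
      using RS by (simp add: cancel)
    moreover have "same_sign ((R ** P) ** A ** (Q ** S))" if "A \<in> G" for A
      using sgn[OF that] by (simp add: matrix_mul_assoc)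
    ultimately have "preserves_cone G" unfolding preserves_cone_def by blast
    then show ?thesis by (simp add: alternatives_def)
  next
    case 4
    have "A \<in> G" if "det A > 0" for A
    proof -
      have "det (P ** A ** Q) > 0" using that det1 by (simp add: det_mul mult.left_commute mult.commute)
      then obtain B where "B \<in> G" "P ** A ** Q = P ** B ** Q" using 4 by blast
      then have "Q ** (P ** A ** Q) ** P = Q ** (P ** B ** Q) ** P" by simp
      then show ?thesis using \<open>B \<in> G\<close> by (simp add: cancel)
    qed
    then have "G = {A. det A > 0}" using det_pos by blast
    then show ?thesis by (simp add: alternatives_def)
  qed
qed

lemma rotation_about_imp_alternatives:
  assumes X: "X ** X = - mat 1" and rot: "\<And>\<theta>. rotation_about X \<theta> \<in> G"
  shows "alternatives G"
proof -
  obtain p q r where X: "X = mat2 p q r (- p)" "p * p + q * r = - 1" "r \<noteq> 0" by (rule mat2_square_eq_minus_1[OF X])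
  define u where "u = 1 / r"
  have u: "r * u = 1" using X(3) by (simp add: u_def)
  \<comment> \<open>The columns are \<open>vec2 1 0\<close> and its image under \<open>X\<close>; in
    this basis \<open>X\<close> is the standard rotation by a right angle.\<close>
  define Q where "Q = mat2 1 p 0 r"
  define P where "P = mat2 1 (- (p * u)) 0 u"
  have PQ: "P ** Q = mat 1"
    unfolding P_def Q_def mat_1_mat2 mat2_mult mat2_eq_iff by (intro conjI; (simp add: algebra_simps; fail | use u in algebra))
  interpret conj: matrix_semigroup "(\<lambda>A. P ** A ** Q) ` G" by (rule conjugate[OF PQ])
  have "P ** rotation_about X \<theta> ** Q = mat2 (cos \<theta>) (- sin \<theta>) (sin \<theta>) (cos \<theta>)" for \<theta>
    unfolding P_def Q_def X(1) rotation_about_def mat_1_mat2 mat2_scaleR mat2_add mat2_mult mat2_eq_iff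
    by (intro conjI; (simp add: algebra_simps; fail | use u X(2) in algebra))
  then have "P ** rotation_about X \<theta> ** Q = cmat (cis \<theta>) 0" for \<theta>
    by (simp add: cmat_def)
  then have "cmat (cis \<theta>) 0 \<in> (\<lambda>A. P ** A ** Q) ` G" for \<theta>
    using imageI[OF rot[of \<theta>], of "\<lambda>A. P ** A ** Q"] by simp
  then show ?thesis
    using alternatives_conjugate[OF PQ] conj.rotations_imp_alternatives by blast
qed

text \<open>Kronecker approximation with nonnegative multiples only: the forward powers already come
  arbitrarily close to any angle modulo \<open>2 * pi\<close>, and closedness of \<open>G\<close>
  supplies the limit. In particular inverses of rotations are obtained.\<close>

lemma irrational_rotation:
  assumes X: "X ** X = - mat 1" and G: "rotation_about X \<theta> \<in> G" and irr: "\<theta> / (2 * pi) \<notin> \<rat>"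
  shows "rotation_about X \<phi> \<in> G"
proof -
  define \<alpha> where "\<alpha> = frac (\<phi> / (2 * pi))"
  have per: "rotation_about X (2 * pi * frac x) = rotation_about X (2 * pi * x)" for x
  proof -
    have "2 * pi * x = 2 * pi * frac x + 2 * pi * of_int \<lfloor>x\<rfloor>"
      unfolding frac_def by (simp add: right_diff_distrib)
    moreover have "cos (2 * pi * frac x + 2 * pi * of_int \<lfloor>x\<rfloor>) = cos (2 * pi * frac x)"
      "sin (2 * pi * frac x + 2 * pi * of_int \<lfloor>x\<rfloor>) = sin (2 * pi * frac x)"
      unfolding cos_add sin_add cos_int_2pin sin_int_2pin by simp_all
    ultimately show ?thesis unfolding rotation_about_def by (simp only:)
  qed
  have "\<exists>k. \<bar>frac (real k * (\<theta> / (2 * pi))) - \<alpha>\<bar> < inverse (real (Suc n))" for n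
  proof -
    have "0 \<le> \<alpha>" "\<alpha> \<le> 1" unfolding \<alpha>_def using frac_lt_1 less_imp_le by (auto simp: frac_ge_0)
    from Kronecker_approx_1_explicit[OF irr this, of "inverse (real (Suc n))"] show ?thesis by auto
  qed
  then obtain k where k: "\<And>n. \<bar>frac (real (k n) * (\<theta> / (2 * pi))) - \<alpha>\<bar> < inverse (real (Suc n))"
    by metis
  define x where "x n = frac (real (k n) * (\<theta> / (2 * pi)))" for n
  have "x \<longlonglongrightarrow> \<alpha>"
  proof (rule LIM_zero_cancel, rule Lim_null_comparison[OF _ LIMSEQ_inverse_real_of_nat])
    show "\<forall>\<^sub>F n in sequentially. norm (x n - \<alpha>) \<le> inverse (real (Suc n))"
      using k by (simp add: x_def less_imp_le)
  qed
  then have lim: "(\<lambda>n. rotation_about X (2 * pi * x n)) \<longlonglongrightarrow> rotation_about X (2 * pi * \<alpha>)"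
    unfolding rotation_about_def by (intro tendsto_intros)
  have pow: "rotation_about X (real m * \<theta>) \<in> G" for m
  proof (induction m)
    case 0 show ?case using one by (simp add: rotation_about_def)
  next
    case (Suc m)
    have "real (Suc m) * \<theta> = \<theta> + real m * \<theta>" by (simp add: algebra_simps)
    then show ?case using mult[OF G Suc] by (simp only: rotation_about_add[OF X])
  qed
  have "rotation_about X (2 * pi * \<alpha>) \<in> G"
  proof (rule limit[OF lim])
    fix n
    have "rotation_about X (2 * pi * x n) = rotation_about X (real (k n) * \<theta>)"
      unfolding x_def per by simp
    then show "rotation_about X (2 * pi * x n) \<in> G" by (simp only: pow)
  qed (simp add: det_rotation_about[OF X])
  then show ?thesis unfolding \<alpha>_def per by simp
qed

text \<open>By Cayley-Hamilton the traceless part of the matrix squares to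
  \<open>- (sin \<theta>)^2\<close> times the identity. Dividing it by \<open>sin \<theta>\<close>
  gives the complex structure about which the matrix is the rotation by
  \<open>\<theta>\<close>.\<close>

lemma elliptic_imp_alternatives:
  assumes G: "mat2 a b c d \<in> G" and det: "a * d - b * c = 1" and tr: "a + d = 2 * cos \<theta>"
    and irr: "\<theta> / (2 * pi) \<notin> \<rat>" and s: "sin \<theta> \<noteq> 0"
  shows "alternatives G"
proof -
  define m where "m = (a - d) / 2"
  have ad: "a = cos \<theta> + m" "d = cos \<theta> - m" using tr by (simp_all add: m_def field_simps)
  have e: "m * m + b * c = - (sin \<theta>)\<^sup>2"
    using det sin_cos_squared_add[of \<theta>] unfolding ad by algebra
  define X where "X = (1 / sin \<theta>) *\<^sub>R mat2 m b c (- m)"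
  define u where "u = 1 / sin \<theta>"
  have u: "u * sin \<theta> = 1" using s by (simp add: u_def)
  have X: "X ** X = mat2 (- 1) 0 0 (- 1)"
    unfolding X_def u_def[symmetric] mat2_scaleR mat2_mult mat2_eq_iff
    by (intro conjI; (simp add: algebra_simps; fail | use e u in algebra))
  have "mat2 (- 1) 0 0 (- 1) = - mat 1" by (simp add: mat_1_mat2 vec_eq_iff forall_2)
  with X have X: "X ** X = - mat 1" by simp
  have "rotation_about X \<theta> = mat2 a b c d"
    unfolding X_def u_def[symmetric] rotation_about_def mat_1_mat2 mat2_scaleR mat2_add mat2_eq_iff
    by (intro conjI; (simp add: algebra_simps; fail | use u ad in algebra))
  then have "rotation_about X \<theta> \<in> G" using G by simp
  then show ?thesis
    using irrational_rotation[OF X _ irr] rotation_about_imp_alternatives[OF X] by blast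
qed

end

section \<open>Invariant intervals\<close>

text \<open>If \<open>a * b < 0\<close>, the form \<open>a * x + b * y\<close> changes sign across
  the interior ray through \<open>(\<bar>b\<bar>, \<bar>a\<bar>)\<close>, while
  \<open>c * x + d * y\<close> has the nonzero value \<open>e\<close> at that point by independence.
  Moving \<open>x\<close> by a small \<open>h\<close> of either sign then makes the product change
  sign.\<close>

lemma quadrant_product_nonneg_row:
  fixes a b c d :: real
  assumes pos: "\<And>x y. x > 0 \<Longrightarrow> y > 0 \<Longrightarrow> (a * x + b * y) * (c * x + d * y) \<ge> 0"
    and det: "a * d - b * c \<noteq> 0"
  shows "a * b \<ge> 0"
proof (rule ccontr)
  assume "\<not> a * b \<ge> 0"
  then have ab: "a * b < 0" by simp
  then have nz: "a \<noteq> 0" "b \<noteq> 0" by auto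
  define e where "e = c * \<bar>b\<bar> + d * \<bar>a\<bar>"
  have root: "a * \<bar>b\<bar> + b * \<bar>a\<bar> = 0"
    using ab by (auto simp: abs_if mult_less_0_iff)
  have e: "e \<noteq> 0"
    using ab det by (auto simp: e_def abs_if mult_less_0_iff algebra_simps)
  have prod: "(a * h) * (e + c * h) \<ge> 0" if "\<bar>h\<bar> < \<bar>b\<bar>" for h
  proof -
    have "(a * (\<bar>b\<bar> + h) + b * \<bar>a\<bar>) * (c * (\<bar>b\<bar> + h) + d * \<bar>a\<bar>) \<ge> 0"
      using that nz by (intro pos) auto
    moreover have "a * (\<bar>b\<bar> + h) + b * \<bar>a\<bar> = a * h" using root by (simp add: distrib_left)
    moreover have "c * (\<bar>b\<bar> + h) + d * \<bar>a\<bar> = e + c * h" by (simp add: e_def distrib_left)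
    ultimately show ?thesis by simp
  qed
  have lim: "((\<lambda>h. a * (e + c * h)) \<longlongrightarrow> a * e) (at 0 within S)" for S
    by (rule tendsto_eq_intros refl | simp)+
  have small: "\<forall>\<^sub>F h in at 0 within S. \<bar>h\<bar> < \<bar>b\<bar>" for S
    unfolding eventually_at using nz by (intro exI[of _ "\<bar>b\<bar>"]) (auto simp: dist_real_def)
  have left: "\<forall>\<^sub>F h in at_left 0. h < (0::real)"
    by (simp add: eventually_at_filter)
  have "0 \<le> a * e"
  proof (rule tendsto_lowerbound[OF lim])
    show "\<forall>\<^sub>F h in at_right 0. 0 \<le> a * (e + c * h)"
      using small eventually_at_right_less[of 0]
    proof eventually_elim
      case (elim h)
      have "0 \<le> (a * (e + c * h)) * h" using prod[OF elim(1)] by (simp add: mult_ac)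
      then show ?case using elim(2) by (simp add: zero_le_mult_iff)
    qed
  qed simp
  moreover have "a * e \<le> 0"
  proof (rule tendsto_upperbound[OF lim])
    show "\<forall>\<^sub>F h in at_left 0. a * (e + c * h) \<le> 0"
      using small left
    proof eventually_elim
      case (elim h)
      have "0 \<le> (a * (e + c * h)) * h" using prod[OF elim(1)] by (simp add: mult_ac)
      then show ?case using elim(2) by (simp add: zero_le_mult_iff)
    qed
  qed simp
  ultimately show False using e nz by auto
qed

text \<open>Rows are compared by the preceding lemma, columns by letting \<open>(x, y)\<close> tend
  to the axes. Diagonal and antidiagonal matrices escape both comparisons, so they are tested at
  \<open>(1, 1)\<close>.\<close>

lemma same_sign_mat2_closed:
  assumes pos: "\<And>x y. x > 0 \<Longrightarrow> y > 0 \<Longrightarrow> (a * x + b * y) * (c * x + d * y) \<ge> 0"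
    and det: "a * d - b * c \<noteq> 0"
  shows "same_sign (mat2 a b c d)"
proof -
  have ab: "a * b \<ge> 0" by (rule quadrant_product_nonneg_row[OF pos det])
  have cd: "c * d \<ge> 0"
    by (rule quadrant_product_nonneg_row[where c = a and d = b]) (use pos det in \<open>auto simp: mult.commute\<close>)
  have ac: "a * c \<ge> 0"
  proof (rule tendsto_lowerbound)
    show "((\<lambda>h. (a * 1 + b * h) * (c * 1 + d * h)) \<longlongrightarrow> a * c) (at_right 0)"
      by (rule tendsto_eq_intros refl | simp)+
    show "\<forall>\<^sub>F h in at_right 0. 0 \<le> (a * 1 + b * h) * (c * 1 + d * h)"
      using eventually_at_right_less[of 0] by eventually_elim (rule pos, auto)
  qed simp
  have bd: "b * d \<ge> 0"
  proof (rule tendsto_lowerbound)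
    show "((\<lambda>h. (a * h + b * 1) * (c * h + d * 1)) \<longlongrightarrow> b * d) (at_right 0)"
      by (rule tendsto_eq_intros refl | simp)+
    show "\<forall>\<^sub>F h in at_right 0. 0 \<le> (a * h + b * 1) * (c * h + d * 1)"
      using eventually_at_right_less[of 0] by eventually_elim (rule pos, auto)
  qed simp
  have ad: "a * d \<ge> 0" if "b = 0" "c = 0" using pos[of 1 1] that by simp
  have bc: "b * c \<ge> 0" if "a = 0" "d = 0" using pos[of 1 1] that by simp
  show ?thesis
    using ab cd ac bd ad bc det unfolding same_sign_def forall_2
    by (simp add: zero_le_mult_iff) (smt (verit) mult_eq_0_iff)
qed

text \<open>
  The exceptional line is needed because slopes say nothing about vertical vectors; it is harmless
  since its complement is dense.
\<close>

lemma same_sign_mat2: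
  assumes pos: "\<And>x y. x > 0 \<Longrightarrow> y > 0 \<Longrightarrow> (a * x + b * y) * (c * x + d * y) \<ge> 0 \<or> l * x + m * y = 0"
    and lm: "l \<noteq> 0 \<or> m \<noteq> 0" and det: "a * d - b * c \<noteq> 0"
  shows "same_sign (mat2 a b c d)"
proof (rule same_sign_mat2_closed[OF _ det], rule ccontr)
  fix x y :: real
  assume xy: "x > 0" "y > 0" and "\<not> (a * x + b * y) * (c * x + d * y) \<ge> 0"
  then have neg: "(a * x + b * y) * (c * x + d * y) < 0" by simp
  with pos[OF xy] have L: "l * x + m * y = 0" by simp
  \<comment> \<open>Leave the exceptional line along a coordinate on which its equation depends.
    Strict negativity survives for small \<open>h\<close>, and off the line it contradicts the
    hypothesis.\<close>
  define p where "p h = (if l \<noteq> 0 then h else 0)" for h :: real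
  define q where "q h = (if l \<noteq> 0 then 0 else h)" for h :: real
  have pq: "(p \<longlongrightarrow> 0) (at_right 0)" "(q \<longlongrightarrow> 0) (at_right 0)"
    unfolding p_def q_def by (cases "l = 0"; simp add: tendsto_ident_at)+
  have "((\<lambda>h. (a * (x + p h) + b * (y + q h)) * (c * (x + p h) + d * (y + q h))) \<longlongrightarrow>
      (a * (x + 0) + b * (y + 0)) * (c * (x + 0) + d * (y + 0))) (at_right 0)"
    by (intro tendsto_intros pq)
  then have "\<forall>\<^sub>F h in at_right 0. (a * (x + p h) + b * (y + q h)) * (c * (x + p h) + d * (y + q h)) < 0"
    by (rule order_tendstoD) (use neg in simp)
  with eventually_at_right_less[of 0]
  have "\<forall>\<^sub>F h in at_right 0. 0 < h \<and> (a * (x + p h) + b * (y + q h)) * (c * (x + p h) + d * (y + q h)) < 0"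
    by (rule eventually_conj)
  then obtain h where h: "0 < h" "(a * (x + p h) + b * (y + q h)) * (c * (x + p h) + d * (y + q h)) < 0"
    using eventually_happens' trivial_limit_at_right_real by blast
  have "x + p h > 0" "y + q h > 0" using xy h(1) by (auto simp: p_def q_def)
  from pos[OF this] h(2) have "l * (x + p h) + m * (y + q h) = 0" by linarith
  then have "l * p h + m * q h = 0" using L by (simp add: distrib_left)
  then show False using lm h(1) by (auto simp: p_def q_def split: if_splits)
qed

context matrix_semigroup
begin

text \<open>The two linear forms are the coordinates of \<open>v\<close> relative to the cone, and
  their product is nonnegative iff \<open>v\<close> or \<open>- v\<close> lies in the closed cone.
  The condition \<open>v $ 1 = 0\<close> describes the exceptional line: \<open>l\<close> and
  \<open>m\<close> below form the first row of \<open>A\<close> times the second matrix.\<close>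

lemma preserves_coneI:
  assumes RQ: "mat2 p q r t ** mat2 p' q' r' t' = mat 1"
    and inv: "\<And>A x y. A \<in> G \<Longrightarrow> x > 0 \<Longrightarrow> y > 0 \<Longrightarrow>
      (let v = A *v vec2 (p' * x + q' * y) (r' * x + t' * y)
       in v $ 1 = 0 \<or> (p * v $ 1 + q * v $ 2) * (r * v $ 1 + t * v $ 2) \<ge> 0)"
  shows "preserves_cone G"
  unfolding preserves_cone_def
proof (rule exI, rule exI, rule conjI[OF RQ], rule ballI)
  fix A assume A: "A \<in> G"
  obtain a b c d where Aeq: "A = mat2 a b c d" by (rule mat2_cases)
  have det: "a * d - b * c > 0" using det_pos[OF A] by (simp add: Aeq)
  have detRQ: "(p * t - q * r) * (p' * t' - q' * r') = 1"
    using arg_cong[OF RQ, of det] unfolding det_mul by simp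
  define l where "l = a * p' + b * r'"
  define m where "m = a * q' + b * t'"
  define n where "n = c * p' + d * r'"
  define k where "k = c * q' + d * t'"
  have lkmn: "l * k - m * n = (a * d - b * c) * (p' * t' - q' * r')"
    by (simp add: l_def m_def n_def k_def algebra_simps)
  then have lkmn0: "l * k - m * n \<noteq> 0" using det detRQ by auto
  have eq: "mat2 p q r t ** A ** mat2 p' q' r' t' = mat2 (p * l + q * n) (p * m + q * k) (r * l + t * n) (r * m + t * k)"
    by (simp add: Aeq l_def m_def n_def k_def algebra_simps)
  show "same_sign (mat2 p q r t ** A ** mat2 p' q' r' t')"
    unfolding eq
  proof (rule same_sign_mat2[where l = l and m = m])
    show "l \<noteq> 0 \<or> m \<noteq> 0" using lkmn0 by auto
    have "(p * l + q * n) * (r * m + t * k) - (p * m + q * k) * (r * l + t * n)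
        = (p * t - q * r) * (l * k - m * n)" by (simp add: algebra_simps)
    then show "(p * l + q * n) * (r * m + t * k) - (p * m + q * k) * (r * l + t * n) \<noteq> 0"
      using lkmn0 detRQ by auto
    fix x y :: real assume xy: "x > 0" "y > 0"
    have v: "A *v vec2 (p' * x + q' * y) (r' * x + t' * y) = vec2 (l * x + m * y) (n * x + k * y)"
      by (simp add: Aeq l_def m_def n_def k_def algebra_simps)
    have e: "(p * l + q * n) * x + (p * m + q * k) * y = p * (l * x + m * y) + q * (n * x + k * y)"
      "(r * l + t * n) * x + (r * m + t * k) * y = r * (l * x + m * y) + t * (n * x + k * y)"
      by (simp_all add: algebra_simps)
    show "((p * l + q * n) * x + (p * m + q * k) * y) * ((r * l + t * n) * x + (r * m + t * k) * y) \<ge> 0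
        \<or> l * x + m * y = 0"
      using inv[OF A xy] unfolding e v Let_def vec2_nth by blast
  qed
qed

text \<open>The cone is spanned by the directions of the end points of \<open>\<Sigma>\<close>:
  \<open>(1, l)\<close> or \<open>(1, u)\<close> for a finite end point, a vertical vector for an
  infinite one, hence the three cases. Convexity puts every interior slope into
  \<open>\<Sigma>\<close>, and image slopes stay between the end points. Only the open quadrant is
  tested, so it does not matter whether \<open>\<Sigma>\<close> contains its end points.\<close>

lemma invariant_interval_imp_preserves_cone:
  fixes \<Sigma> :: "real set"
  assumes conv: "\<And>s s' x. s \<in> \<Sigma> \<Longrightarrow> s' \<in> \<Sigma> \<Longrightarrow> s \<le> x \<Longrightarrow> x \<le> s' \<Longrightarrow> x \<in> \<Sigma>"
    and two: "s0 \<in> \<Sigma>" "s1 \<in> \<Sigma>" "s0 < s1"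
    and inv: "\<And>a b c d s. mat2 a b c d \<in> G \<Longrightarrow> s \<in> \<Sigma> \<Longrightarrow> a + b * s \<noteq> 0 \<Longrightarrow> (c + d * s) / (a + b * s) \<in> \<Sigma>"
    and bdd: "bdd_above \<Sigma> \<or> bdd_below \<Sigma>"
  shows "preserves_cone G"
proof -
  have inv': "v $ 1 = 0 \<or> v $ 2 / v $ 1 \<in> \<Sigma>"
    if A: "A \<in> G" and s: "y / x \<in> \<Sigma>" and x: "x \<noteq> 0" and v: "v = A *v vec2 x y" for A x y v
  proof -
    obtain a b c d where Aeq: "A = mat2 a b c d" by (rule mat2_cases)
    have "v $ 1 = x * (a + b * (y / x))" "v $ 2 = x * (c + d * (y / x))"
      using x by (simp_all add: v Aeq distrib_left)
    then show ?thesis using inv[OF A[unfolded Aeq] s] x by auto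
  qed
  consider (both) "bdd_above \<Sigma>" "bdd_below \<Sigma>" | (above) "bdd_above \<Sigma>" "\<not> bdd_below \<Sigma>"
    | (below) "\<not> bdd_above \<Sigma>" "bdd_below \<Sigma>"
    using bdd by (cases "bdd_above \<Sigma>"; cases "bdd_below \<Sigma>") auto
  then show ?thesis
  proof cases
    case both
    define l where "l = Inf \<Sigma>"
    define u where "u = Sup \<Sigma>"
    have lu: "l \<le> s" "s \<le> u" if "s \<in> \<Sigma>" for s
      using cInf_lower[OF that both(2)] cSup_upper[OF that both(1)] by (simp_all add: l_def u_def)
    have "l < u" using lu(1)[OF two(1)] lu(2)[OF two(2)] two(3) by linarith
    have mem: "s \<in> \<Sigma>" if s: "l < s" "s < u" for s
    proof -
      obtain s' where "s' \<in> \<Sigma>" "s < s'" using less_cSupD[of \<Sigma> s] two s(2) unfolding u_def by blast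
      moreover obtain s'' where "s'' \<in> \<Sigma>" "s'' < s" using cInf_lessD[of \<Sigma> s] two s(1) unfolding l_def by blast
      ultimately show ?thesis using conv[of s'' s' s] by simp
    qed
    define w where "w = 1 / (u - l)"
    have w: "w > 0" "w * (u - l) = 1" using \<open>l < u\<close> by (simp_all add: w_def)
    show ?thesis
    proof (rule preserves_coneI)
      show "mat2 (w * u) (- w) (- (w * l)) w ** mat2 1 1 l u = mat 1"
        using w(2) by (simp add: mat_1_mat2 algebra_simps)
      fix A x y assume A: "A \<in> G" and xy: "x > (0::real)" "y > (0::real)"
      define v where "v = A *v vec2 (1 * x + 1 * y) (l * x + u * y)"
      have "(l * x + u * y) / (x + y) \<in> \<Sigma>"
      proof (rule mem)
        show "l < (l * x + u * y) / (x + y)"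
          using xy \<open>l < u\<close> by (simp add: pos_less_divide_eq distrib_left)
        show "(l * x + u * y) / (x + y) < u"
          using xy \<open>l < u\<close> by (simp add: pos_divide_less_eq distrib_left)
      qed
      then have "v $ 1 = 0 \<or> v $ 2 / v $ 1 \<in> \<Sigma>"
        using xy by (intro inv'[OF A _ _ v_def]) auto
      then show "let v = A *v vec2 (1 * x + 1 * y) (l * x + u * y) in v $ 1 = 0 \<or>
          (w * u * v $ 1 + - w * v $ 2) * (- (w * l) * v $ 1 + w * v $ 2) \<ge> 0"
        unfolding Let_def v_def[symmetric]
      proof
        assume m: "v $ 2 / v $ 1 \<in> \<Sigma>"
        define m where "m = v $ 2 / v $ 1"
        have "(w * v $ 1)\<^sup>2 * ((u - m) * (m - l)) \<ge> 0"
          using lu[OF m] by (simp add: m_def)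
        moreover have "(w * u * v $ 1 + - w * v $ 2) * (- (w * l) * v $ 1 + w * v $ 2)
            = (w * v $ 1)\<^sup>2 * ((u - m) * (m - l))" if "v $ 1 \<noteq> 0"
        proof -
          have "v $ 2 = m * v $ 1" using that by (simp add: m_def)
          then show ?thesis by (simp add: power2_eq_square algebra_simps)
        qed
        ultimately show "v $ 1 = 0 \<or> (w * u * v $ 1 + - w * v $ 2) * (- (w * l) * v $ 1 + w * v $ 2) \<ge> 0"
          by (cases "v $ 1 = 0") simp_all
      qed simp
    qed
  next
    case above
    define u where "u = Sup \<Sigma>"
    have lu: "s \<le> u" if "s \<in> \<Sigma>" for s
      using cSup_upper[OF that above(1)] by (simp_all add: u_def)
    have mem: "s \<in> \<Sigma>" if s: "s < u" for s
    proof -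
      obtain s' where "s' \<in> \<Sigma>" "s < s'" using less_cSupD[of \<Sigma> s] two s unfolding u_def by blast
      moreover obtain s'' where "s'' \<in> \<Sigma>" "s'' < s" using above(2) by (meson bdd_below.I not_le)
      ultimately show ?thesis using conv[of s'' s' s] by simp
    qed
    show ?thesis
    proof (rule preserves_coneI)
      \<comment> \<open>The columns of the second factor are the edges \<open>(0, - 1)\<close>, for
        slope tending to minus infinity, and \<open>(1, u)\<close>.\<close>
      show "mat2 u (- 1) 1 0 ** mat2 0 1 (- 1) u = mat 1"
        by (simp add: mat_1_mat2)
      fix A x y assume A: "A \<in> G" and xy: "x > (0::real)" "y > (0::real)"
      define v where "v = A *v vec2 (0 * x + 1 * y) (- 1 * x + u * y)"
      have "(- 1 * x + u * y) / (0 * x + 1 * y) \<in> \<Sigma>"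
        by (rule mem) (use xy in \<open>simp add: pos_divide_less_eq\<close>)
      then have "v $ 1 = 0 \<or> v $ 2 / v $ 1 \<in> \<Sigma>"
        using xy by (intro inv'[OF A _ _ v_def]) auto
      then show "let v = A *v vec2 (0 * x + 1 * y) (- 1 * x + u * y) in v $ 1 = 0 \<or>
          (u * v $ 1 + - 1 * v $ 2) * (1 * v $ 1 + 0 * v $ 2) \<ge> 0"
        unfolding Let_def v_def[symmetric]
      proof
        assume m: "v $ 2 / v $ 1 \<in> \<Sigma>"
        define m where "m = v $ 2 / v $ 1"
        have "(v $ 1)\<^sup>2 * (u - m) \<ge> 0"
          using lu[OF m] by (simp add: m_def)
        moreover have "(u * v $ 1 + - 1 * v $ 2) * (1 * v $ 1 + 0 * v $ 2) = (v $ 1)\<^sup>2 * (u - m)" if "v $ 1 \<noteq> 0"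
        proof -
          have "v $ 2 = m * v $ 1" using that by (simp add: m_def)
          then show ?thesis by (simp add: power2_eq_square algebra_simps)
        qed
        ultimately show "v $ 1 = 0 \<or> (u * v $ 1 + - 1 * v $ 2) * (1 * v $ 1 + 0 * v $ 2) \<ge> 0"
          by (cases "v $ 1 = 0") simp_all
      qed simp
    qed
  next
    case below
    define l where "l = Inf \<Sigma>"
    have lu: "l \<le> s" if "s \<in> \<Sigma>" for s
      using cInf_lower[OF that below(2)] by (simp_all add: l_def)
    have mem: "s \<in> \<Sigma>" if s: "l < s" for s
    proof -
      obtain s'' where "s'' \<in> \<Sigma>" "s'' < s" using cInf_lessD[of \<Sigma> s] two s unfolding l_def by blast
      moreover obtain s' where "s' \<in> \<Sigma>" "s < s'" using below(1) by (meson bdd_above.I not_le)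
      ultimately show ?thesis using conv[of s'' s' s] by simp
    qed
    show ?thesis
    proof (rule preserves_coneI)
      show "mat2 (- l) 1 1 0 ** mat2 0 1 1 l = mat 1"
        by (simp add: mat_1_mat2)
      fix A x y assume A: "A \<in> G" and xy: "x > (0::real)" "y > (0::real)"
      define v where "v = A *v vec2 (0 * x + 1 * y) (1 * x + l * y)"
      have "(1 * x + l * y) / (0 * x + 1 * y) \<in> \<Sigma>"
        by (rule mem) (use xy in \<open>simp add: pos_less_divide_eq\<close>)
      then have "v $ 1 = 0 \<or> v $ 2 / v $ 1 \<in> \<Sigma>"
        using xy by (intro inv'[OF A _ _ v_def]) auto
      then show "let v = A *v vec2 (0 * x + 1 * y) (1 * x + l * y) in v $ 1 = 0 \<or>
          (- l * v $ 1 + 1 * v $ 2) * (1 * v $ 1 + 0 * v $ 2) \<ge> 0"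
        unfolding Let_def v_def[symmetric]
      proof
        assume m: "v $ 2 / v $ 1 \<in> \<Sigma>"
        define m where "m = v $ 2 / v $ 1"
        have "(v $ 1)\<^sup>2 * (m - l) \<ge> 0"
          using lu[OF m] by (simp add: m_def)
        moreover have "(- l * v $ 1 + 1 * v $ 2) * (1 * v $ 1 + 0 * v $ 2) = (v $ 1)\<^sup>2 * (m - l)" if "v $ 1 \<noteq> 0"
        proof -
          have "v $ 2 = m * v $ 1" using that by (simp add: m_def)
          then show ?thesis by (simp add: power2_eq_square algebra_simps)
        qed
        ultimately show "v $ 1 = 0 \<or> (- l * v $ 1 + 1 * v $ 2) * (1 * v $ 1 + 0 * v $ 2) \<ge> 0"
          by (cases "v $ 1 = 0") simp_all
      qed simp
    qed
  qed
qed

end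

section \<open>Hyperbolic and parabolic flows\<close>

context matrix_semigroup
begin

text \<open>The scalar \<open>c\<close> normalises the determinant to 1. The trace then falls from a
  positive to a nonpositive value, so \<open>2 * cos \<theta>\<close> is attained for every
  \<open>\<theta>\<close> slightly below \<open>pi / 2\<close>, and among these angles some are
  irrational multiples of \<open>2 * pi\<close>.\<close>

lemma trace_path_imp_alternatives_aux:
  fixes M :: "real \<Rightarrow> real^2^2"
  assumes cont: "continuous_on {a..b} (\<lambda>s. M s $ 1 $ 1 + M s $ 2 $ 2)"
    and G: "\<And>s. s \<in> {a..b} \<Longrightarrow> M s \<in> G" and det: "\<And>s. s \<in> {a..b} \<Longrightarrow> det (M s) = D"
    and ab: "a \<le> b" and sgn: "(M a $ 1 $ 1 + M a $ 2 $ 2) * (M b $ 1 $ 1 + M b $ 2 $ 2) < 0"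
    and c: "c * c * D = 1" and pos: "c * (M a $ 1 $ 1 + M a $ 2 $ 2) > 0"
  shows "alternatives G"
proof -
  define f where "f s = c * (M s $ 1 $ 1 + M s $ 2 $ 2)" for s
  \<comment> \<open>An upper bound for \<open>cos \<theta>\<close>: at most \<open>f a / 2\<close>,
    so that \<open>2 * cos \<theta>\<close> lies in the range of the trace, and at most 1, so that
    \<open>arccos\<close> applies.\<close>
  define y where "y = min (f a / 2) 1"
  have fa: "f a > 0" using pos by (simp add: f_def)
  then have y: "0 < y" "y \<le> 1" "2 * y \<le> f a" by (auto simp: y_def min_def)
  have c0: "c \<noteq> 0" using c by auto
  have "f a * f b = (c * c) * ((M a $ 1 $ 1 + M a $ 2 $ 2) * (M b $ 1 $ 1 + M b $ 2 $ 2))"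
    by (simp add: f_def)
  moreover have "0 < c * c" using c0 not_square_less_zero[of c] by (simp add: less_le)
  ultimately have "f a * f b < 0" using mult_pos_neg[OF _ sgn] by presburger
  then have fb: "f b \<le> 0" using fa by (simp add: mult_less_0_iff)
  have "arccos y < pi / 2"
    using arccos_less_arccos[of 0 y] y by simp
  then have "arccos y / (2 * pi) < 1 / 4" by (simp add: field_simps)
  from exists_irrational_between[OF this] obtain x
    where x: "arccos y / (2 * pi) < x" "x < 1 / 4" "x \<notin> \<rat>" by blast
  define \<theta> where "\<theta> = 2 * pi * x"
  have th: "arccos y < \<theta>" "\<theta> < pi / 2" "\<theta> / (2 * pi) \<notin> \<rat>"
    using x by (simp_all add: \<theta>_def field_simps)
  have th0: "0 < \<theta>" using arccos_lbound[of y] y th(1) by linarith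
  have "cos \<theta> < cos (arccos y)"
    using cos_monotone_0_pi[of "arccos y" \<theta>] arccos_lbound[of y] y th by simp
  then have cy: "cos \<theta> < y" using y by simp
  have cp: "0 < cos \<theta>" using th0 th(2) by (intro cos_gt_zero) auto
  have "continuous_on {a..b} f" unfolding f_def by (intro continuous_intros cont)
  then obtain s where s: "a \<le> s" "s \<le> b" "f s = 2 * cos \<theta>"
    using IVT2'[of f b "2 * cos \<theta>" a] fb cp cy y(3) ab by auto
  obtain p q r t where Ms: "M s = mat2 p q r t" by (rule mat2_cases)
  have "c *\<^sub>R M s \<in> G" using s by (intro scale G c0) simp
  then have inG: "mat2 (c * p) (c * q) (c * r) (c * t) \<in> G" by (simp add: Ms)
  have "p * t - q * r = D" using det[of s] s by (simp add: Ms)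
  then have d: "(c * p) * (c * t) - (c * q) * (c * r) = 1"
  proof -
    have "(c * p) * (c * t) - (c * q) * (c * r) = c * c * (p * t - q * r)" by (simp add: algebra_simps)
    then show ?thesis using \<open>p * t - q * r = D\<close> c by simp
  qed
  have tr: "c * p + c * t = 2 * cos \<theta>" using s(3) by (simp add: f_def Ms distrib_left)
  have "sin \<theta> \<noteq> 0" using sin_gt_zero[of \<theta>] th0 th(2) by simp
  then show ?thesis by (rule elliptic_imp_alternatives[OF inG d tr th(3)])
qed

lemma trace_path_imp_alternatives:
  fixes M :: "real \<Rightarrow> real^2^2"
  assumes cont: "continuous_on {a..b} (\<lambda>s. M s $ 1 $ 1 + M s $ 2 $ 2)"
    and G: "\<And>s. s \<in> {a..b} \<Longrightarrow> M s \<in> G" and det: "\<And>s. s \<in> {a..b} \<Longrightarrow> det (M s) = D"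
    and ab: "a \<le> b" and sgn: "(M a $ 1 $ 1 + M a $ 2 $ 2) * (M b $ 1 $ 1 + M b $ 2 $ 2) < 0"
  shows "alternatives G"
proof -
  have D: "D > 0" using det[of a] det_pos[OF G[of a]] ab by simp
  define c where "c = 1 / sqrt D"
  have c: "c * c * D = 1" "0 < c" using D by (simp_all add: c_def)
  have "M a $ 1 $ 1 + M a $ 2 $ 2 \<noteq> 0" using sgn by (metis less_irrefl mult_zero_left)
  then consider "M a $ 1 $ 1 + M a $ 2 $ 2 > 0" | "M a $ 1 $ 1 + M a $ 2 $ 2 < 0" by linarith
  then show ?thesis
  proof cases
    case 1
    then show ?thesis using c by (intro trace_path_imp_alternatives_aux[OF cont G det ab sgn c(1)]) simp_all
  next
    case 2
    \<comment> \<open>The negative square root makes the initial trace positive.\<close>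
    have c': "(- c) * (- c) * D = 1" using c by simp
    show ?thesis
      by (rule trace_path_imp_alternatives_aux[OF cont G det ab sgn c'])
         (use 2 c in \<open>simp_all only: mult_neg_neg neg_less_0_iff_less\<close>)
  qed
qed

lemma hyperbolic_flow_imp_alternatives:
  assumes D: "\<And>t. t \<ge> 0 \<Longrightarrow> mat2 (exp t) 0 0 (exp (- t)) \<in> G"
  shows "alternatives G"
proof -
  \<comment> \<open>the slopes of the images of the attracting vector \<open>(1, 0)\<close>\<close>
  define \<Sigma> where "\<Sigma> = {c / a |a b c d. mat2 a b c d \<in> G \<and> a \<noteq> 0}"
  have memI: "c / a \<in> \<Sigma>" if "mat2 a b c d \<in> G" "a \<noteq> 0" for a b c d
    using that unfolding \<Sigma>_def by blast
  have zero: "0 \<in> \<Sigma>" using one unfolding \<Sigma>_def mat_1_mat2 by force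
  \<comment> \<open>The flow multiplies slopes by \<open>exp (- 2 * t)\<close>, so
    \<open>\<Sigma>\<close> is star-shaped about 0 and therefore an interval.\<close>
  have contract: "exp (- 2 * t) * s \<in> \<Sigma>" if s: "s \<in> \<Sigma>" and t: "t \<ge> 0" for s t
  proof -
    obtain a b c d where h: "mat2 a b c d \<in> G" "a \<noteq> 0" "s = c / a" using s by (auto simp: \<Sigma>_def)
    have "mat2 (exp t * a) (exp t * b) (exp (- t) * c) (exp (- t) * d) \<in> G"
      using mult[OF D[OF t] h(1)] by simp
    then have "exp (- t) * c / (exp t * a) \<in> \<Sigma>" by (rule memI) (simp add: h(2))
    moreover have "exp (- 2 * t) * s = exp (- t) * c / (exp t * a)"
    proof -
      have "exp (- 2 * t) = exp (- t) / exp t" by (simp flip: exp_diff)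
      then show ?thesis by (simp add: h(3))
    qed
    ultimately show ?thesis by (simp only:)
  qed
  have star: "r * s \<in> \<Sigma>" if s: "s \<in> \<Sigma>" and r: "0 \<le> r" "r \<le> 1" for r s
  proof (cases "r = 0")
    case True then show ?thesis using zero by simp
  next
    case False
    then have r0: "0 < r" using r by simp
    then have "exp (- 2 * (- ln r / 2)) = r" by simp
    moreover have "0 \<le> - ln r / 2" using r0 r(2) by simp
    ultimately show ?thesis using contract[OF s] by metis
  qed
  have between: "x \<in> \<Sigma>" if "s \<in> \<Sigma>" "0 \<le> x \<and> x \<le> s \<or> s \<le> x \<and> x \<le> 0" for s x
  proof (cases "s = 0")
    case True then show ?thesis using that zero by auto
  next
    case False
    then have "0 \<le> x / s" "x / s \<le> 1" "x = (x / s) * s"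
      using that(2) by (auto simp: divide_le_eq_1 zero_le_divide_iff)
    then show ?thesis using star[OF that(1)] by metis
  qed
  have conv: "x \<in> \<Sigma>" if "s \<in> \<Sigma>" "s' \<in> \<Sigma>" "s \<le> x" "x \<le> s'" for s s' x
    using between[of s x] between[of s' x] that by linarith
  have inv: "(c + d * s) / (a + b * s) \<in> \<Sigma>"
    if A: "mat2 a b c d \<in> G" and s: "s \<in> \<Sigma>" and nz: "a + b * s \<noteq> 0" for a b c d s
  proof -
    obtain a' b' c' d' where h: "mat2 a' b' c' d' \<in> G" "a' \<noteq> 0" "s = c' / a'" using s by (auto simp: \<Sigma>_def)
    have e: "a * a' + b * c' = a' * (a + b * s)" "c * a' + d * c' = a' * (c + d * s)"
      using h by (simp_all add: distrib_left)
    have "(c * a' + d * c') / (a * a' + b * c') \<in> \<Sigma>"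
      using memI[OF mult[OF A h(1), unfolded mat2_mult]] nz h(2) e(1) by simp
    then show ?thesis unfolding e using h(2) by simp
  qed
  have "\<Sigma> = {0} \<or> (\<exists>s\<in>\<Sigma>. s \<noteq> 0)" using zero by blast
  then consider (single) "\<Sigma> = {0}" | (interval) s where "s \<in> \<Sigma>" "s \<noteq> 0" "bdd_above \<Sigma> \<or> bdd_below \<Sigma>"
    | (full) "\<not> bdd_above \<Sigma>" "\<not> bdd_below \<Sigma>"
    by metis
  then show ?thesis
  proof cases
    case single
    \<comment> \<open>An image of \<open>vec2 1 0\<close> has slope 0 or is vertical, which leaves
      two directions.\<close>
    have "\<exists>c. A *v vec2 1 0 = c *\<^sub>R vec2 1 0 \<or> A *v vec2 1 0 = c *\<^sub>R vec2 0 1" if A: "A \<in> G" for A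
    proof -
      obtain a b c d where Aeq: "A = mat2 a b c d" by (rule mat2_cases)
      have "c = 0 \<or> a = 0"
      proof (rule ccontr)
        assume n: "\<not> (c = 0 \<or> a = 0)"
        then have "c / a \<in> \<Sigma>" using A unfolding Aeq \<Sigma>_def by blast
        then show False using n single by simp
      qed
      then show ?thesis by (auto simp: Aeq)
    qed
    then have "finite_real_orbit G" unfolding finite_real_orbit_def
      by (intro exI[of _ "vec2 1 0"] exI[of _ "vec2 0 1"]) simp
    then show ?thesis by (simp add: alternatives_def)
  next
    case interval
    have "preserves_cone G"
    proof (cases "s > 0")
      case True
      show ?thesis
        by (rule invariant_interval_imp_preserves_cone[OF conv zero interval(1) True inv interval(3)])
    next
      case False
      then have "s < 0" using interval(2) by linarith
      show ?thesis
        by (rule invariant_interval_imp_preserves_cone[OF conv interval(1) zero \<open>s < 0\<close> inv interval(3)])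
    qed
    then show ?thesis by (simp add: alternatives_def)
  next
    case full
    have all: "x \<in> \<Sigma>" for x
    proof -
      obtain s' where "s' \<in> \<Sigma>" "x < s'" using full(1) by (meson bdd_above.I not_le)
      moreover obtain s where "s \<in> \<Sigma>" "s < x" using full(2) by (meson bdd_below.I not_le)
      ultimately show ?thesis using conv[of s s' x] by simp
    qed
    show ?thesis
    proof (cases "\<exists>a b c d. mat2 a b c d \<in> G \<and> a \<noteq> 0 \<and> b \<noteq> 0")
      case True
      then obtain k1 k2 k3 k4 where k: "mat2 k1 k2 k3 k4 \<in> G" "k1 \<noteq> 0" "k2 \<noteq> 0" by blast
      \<comment> \<open>This slope makes the dominant part of the trace of \<open>M s\<close> below proportional to
        \<open>exp s - 2 * exp (- s)\<close>, which changes sign.\<close>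
      from all[of "- 2 * k1 / k2"] obtain h1 h2 h3 h4
        where h: "mat2 h1 h2 h3 h4 \<in> G" "h1 \<noteq> 0" "h3 / h1 = - 2 * k1 / k2" unfolding \<Sigma>_def by force
      have hk: "h3 * k2 = - 2 * (h1 * k1)" using h(2,3) k(3) by (simp add: field_simps)
      define P where "P = h1 * k1"
      define C where "C = \<bar>h2 * k3\<bar> + \<bar>h4 * k4\<bar>"
      \<comment> \<open>Since \<open>exp t \<ge> 1 + t\<close>, this makes
        \<open>\<bar>W\<bar>\<close> exceed \<open>2 * C\<close>, a bound for \<open>V\<close> at
        arguments between 1 and 2. The factor \<open>exp s - 2 * exp (- s)\<close> is -1 at
        \<open>s = 0\<close> and 1 at \<open>s = ln 2\<close>, so the trace takes the signs of
        \<open>- W\<close> and \<open>W\<close> there.\<close>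
      define t where "t = 2 * C / \<bar>P\<bar>"
      have P: "\<bar>P\<bar> > 0" using h(2) k(2) by (simp add: P_def)
      have t: "t \<ge> 0" by (simp add: t_def C_def)
      define M where "M s = mat2 (exp s) 0 0 (exp (- s)) ** (mat2 h1 h2 h3 h4 **
          (mat2 (exp t) 0 0 (exp (- t)) ** mat2 k1 k2 k3 k4))" for s
      have G: "M s \<in> G" if "s \<in> {0..ln 2}" for s
        using that t unfolding M_def by (intro mult D h(1) k(1)) auto
      have det: "det (M s) = det (mat2 h1 h2 h3 h4) * det (mat2 k1 k2 k3 k4)" for s
        unfolding M_def det_mul det_mat2[of "exp _"] by (simp flip: exp_add)
      define W where "W = exp t * P"
      define V where "V x = x * exp (- t) * (h2 * k3) + inverse x * exp (- t) * (h4 * k4)" for x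
      have tr: "M s $ 1 $ 1 + M s $ 2 $ 2 = (exp s - 2 * exp (- s)) * W + V (exp s)" for s
      proof -
        have "M s $ 1 $ 1 + M s $ 2 $ 2 = exp s * exp t * (h1 * k1) + exp s * exp (- t) * (h2 * k3)
            + exp (- s) * exp t * (h3 * k2) + exp (- s) * exp (- t) * (h4 * k4)"
          by (simp add: M_def algebra_simps)
        then show ?thesis unfolding hk by (simp add: W_def V_def P_def exp_minus algebra_simps)
      qed
      have W: "2 * C < \<bar>W\<bar>"
      proof -
        have "2 * C < (1 + t) * \<bar>P\<bar>" using P by (simp add: t_def distrib_right)
        also have "\<dots> \<le> exp t * \<bar>P\<bar>" using P by (intro mult_right_mono exp_ge_add_one_self) simp
        finally show ?thesis by (simp add: W_def abs_mult)
      qed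
      have V: "\<bar>V x\<bar> \<le> 2 * C" if x: "1 \<le> x" "x \<le> 2" for x
      proof -
        have e: "0 \<le> exp (- t)" "exp (- t) \<le> 1" using t by simp_all
        have "\<bar>x * exp (- t) * (h2 * k3)\<bar> \<le> 2 * \<bar>h2 * k3\<bar>"
          unfolding abs_mult[of "x * exp (- t)"]
          using mult_mono[OF x(2) e(2)] x(1) by (intro mult_right_mono) simp_all
        moreover have "\<bar>inverse x * exp (- t) * (h4 * k4)\<bar> \<le> 1 * \<bar>h4 * k4\<bar>"
          unfolding abs_mult[of "inverse x * exp (- t)"]
        proof (rule mult_right_mono)
          have "inverse x \<le> 1" using x(1) by (simp add: inverse_le_1_iff)
          then show "\<bar>inverse x * exp (- t)\<bar> \<le> 1"
            using mult_mono[of "inverse x" 1 "exp (- t)" 1] e x(1) by simp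
        qed simp
        ultimately have "\<bar>V x\<bar> \<le> 2 * \<bar>h2 * k3\<bar> + 1 * \<bar>h4 * k4\<bar>"
          unfolding V_def by (intro order_trans[OF abs_triangle_ineq add_mono])
        also have "\<dots> \<le> 2 * C" unfolding C_def by simp
        finally show ?thesis .
      qed
      show ?thesis
      proof (rule trace_path_imp_alternatives[OF _ G det])
        show "continuous_on {0..ln 2} (\<lambda>s. M s $ 1 $ 1 + M s $ 2 $ 2)"
          unfolding tr V_def by (intro continuous_intros) auto
        have "M 0 $ 1 $ 1 + M 0 $ 2 $ 2 = - W + V 1" unfolding tr by simp
        moreover have "M (ln 2) $ 1 $ 1 + M (ln 2) $ 2 $ 2 = W + V 2" unfolding tr by (simp add: exp_minus)
        moreover have "(- W + V 1) * (W + V 2) < 0"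
        proof (cases "W > 0")
          case True
          then have "- W + V 1 < 0" "W + V 2 > 0" using W V[of 1] V[of 2] by linarith+
          then show ?thesis by (rule mult_neg_pos)
        next
          case False
          then have "- W + V 1 > 0" "W + V 2 < 0" using W V[of 1] V[of 2] by linarith+
          then show ?thesis by (rule mult_pos_neg)
        qed
        ultimately show "(M 0 $ 1 $ 1 + M 0 $ 2 $ 2) * (M (ln 2) $ 1 $ 1 + M (ln 2) $ 2 $ 2) < 0" by simp
      qed auto
    next
      case False
      have "\<exists>c. A *v vec2 0 1 = c *\<^sub>R vec2 0 1 \<or> A *v vec2 0 1 = c *\<^sub>R vec2 1 0" if A: "A \<in> G" for A
      proof -
        obtain a b c d where Aeq: "A = mat2 a b c d" by (rule mat2_cases)
        have "b = 0 \<or> d = 0"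
        proof (rule ccontr)
          assume n: "\<not> (b = 0 \<or> d = 0)"
          then have "a = 0" using False A unfolding Aeq by blast
          moreover have "c \<noteq> 0" using det_pos[OF A] by (auto simp: Aeq \<open>a = 0\<close>)
          \<comment> \<open>The square of \<open>A\<close> has the first row
            \<open>(b * c, b * d)\<close> without a zero entry, which the case excludes.\<close>
          moreover have "mat2 (b * c) (b * d) (d * c) (c * b + d * d) \<in> G"
            using mult[OF A A] by (simp add: Aeq \<open>a = 0\<close>)
          ultimately show False using False n by (metis mult_eq_0_iff)
        qed
        then show ?thesis by (auto simp: Aeq)
      qed
      then have "finite_real_orbit G" unfolding finite_real_orbit_def
        by (intro exI[of _ "vec2 0 1"] exI[of _ "vec2 1 0"]) simp
      then show ?thesis by (simp add: alternatives_def)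
    qed
  qed
qed

lemma parabolic_flow_imp_alternatives:
  assumes N: "\<And>t. t \<ge> 0 \<Longrightarrow> mat2 1 0 (- t) 1 \<in> G"
  shows "alternatives G"
proof -
  \<comment> \<open>the slopes of the images of the fixed vector \<open>(0, 1)\<close>\<close>
  define \<Sigma> where "\<Sigma> = {d / b |a b c d. mat2 a b c d \<in> G \<and> b \<noteq> 0}"
  have memI: "d / b \<in> \<Sigma>" if "mat2 a b c d \<in> G" "b \<noteq> 0" for a b c d
    using that unfolding \<Sigma>_def by blast
  \<comment> \<open>The flow subtracts \<open>t\<close> from every slope, so \<open>\<Sigma>\<close>
    is closed downwards.\<close>
  have shift: "s - t \<in> \<Sigma>" if s: "s \<in> \<Sigma>" and t: "t \<ge> 0" for s t
  proof -
    obtain a b c d where h: "mat2 a b c d \<in> G" "b \<noteq> 0" "s = d / b" using s by (auto simp: \<Sigma>_def)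
    have "mat2 a b (c - t * a) (d - t * b) \<in> G"
      using mult[OF N[OF t] h(1)] by simp
    moreover have "s - t = (d - t * b) / b" using h by (simp add: field_simps)
    ultimately show ?thesis using h(2) unfolding \<Sigma>_def by blast
  qed
  have down: "x \<in> \<Sigma>" if "s \<in> \<Sigma>" "x \<le> s" for s x
    using shift[OF that(1), of "s - x"] that(2) by simp
  have inv: "(c + d * s) / (a + b * s) \<in> \<Sigma>"
    if A: "mat2 a b c d \<in> G" and s: "s \<in> \<Sigma>" and nz: "a + b * s \<noteq> 0" for a b c d s
  proof -
    obtain a' b' c' d' where h: "mat2 a' b' c' d' \<in> G" "b' \<noteq> 0" "s = d' / b'" using s by (auto simp: \<Sigma>_def)
    have e: "a * b' + b * d' = b' * (a + b * s)" "c * b' + d * d' = b' * (c + d * s)"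
      using h by (simp_all add: distrib_left)
    have "(c * b' + d * d') / (a * b' + b * d') \<in> \<Sigma>"
      using memI[OF mult[OF A h(1), unfolded mat2_mult]] nz h(2) e(1) by simp
    then show ?thesis unfolding e using h(2) by simp
  qed
  have "\<Sigma> = {} \<or> (\<exists>s. s \<in> \<Sigma>)" by blast
  then consider (empty) "\<Sigma> = {}" | (interval) s where "s \<in> \<Sigma>" "bdd_above \<Sigma>"
    | (full) k where "k \<in> \<Sigma>" "\<not> bdd_above \<Sigma>"
    by metis
  then show ?thesis
  proof cases
    case empty
    \<comment> \<open>\<open>\<Sigma>\<close> leaves out the vertical direction, so if it is empty,
      the direction of \<open>vec2 0 1\<close> is fixed.\<close>
    have "\<exists>c. A *v vec2 0 1 = c *\<^sub>R vec2 0 1 \<or> A *v vec2 0 1 = c *\<^sub>R vec2 0 1" if A: "A \<in> G" for A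
    proof -
      obtain a b c d where Aeq: "A = mat2 a b c d" by (rule mat2_cases)
      have "b = 0" using empty A unfolding Aeq \<Sigma>_def by blast
      then show ?thesis by (auto simp: Aeq)
    qed
    then have "finite_real_orbit G" unfolding finite_real_orbit_def
      by (intro exI[of _ "vec2 0 1"]) simp
    then show ?thesis by (simp add: alternatives_def)
  next
    case interval
    have "preserves_cone G"
    proof (rule invariant_interval_imp_preserves_cone[OF _ _ interval(1) _ inv])
      show "s - 1 \<in> \<Sigma>" by (rule down[OF interval(1)]) simp
      show "x \<in> \<Sigma>" if "s' \<in> \<Sigma>" "x \<le> s'" for x s' by (rule down[OF that])
      show "bdd_above \<Sigma> \<or> bdd_below \<Sigma>" using interval(2) by (rule disjI1)
    qed simp
    then show ?thesis by (simp add: alternatives_def)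
  next
    case full
    from full(1) obtain k1 k2 k3 k4 where k: "mat2 k1 k2 k3 k4 \<in> G" "k2 \<noteq> 0" unfolding \<Sigma>_def by blast
    \<comment> \<open>The lower bound on the slope makes \<open>\<sigma>\<close> positive, so the
      sign change near \<open>s = \<sigma>\<close> is reached by the flow at a nonnegative
      time.\<close>
    obtain s where "s \<in> \<Sigma>" "- k1 / k2 < s" using full(2) by (meson bdd_above.I not_le)
    then obtain h1 h2 h3 h4 where h: "mat2 h1 h2 h3 h4 \<in> G" "h2 \<noteq> 0" "- k1 / k2 < h4 / h2" unfolding \<Sigma>_def by blast
    \<comment> \<open>For large \<open>t\<close>, the trace of \<open>M s\<close> below is dominated by a multiple of \<open>\<sigma> - s\<close>.\<close>
    define \<sigma> where "\<sigma> = k1 / k2 + h4 / h2"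
    define K where "K = h2 * k2"
    define T where "T = h1 * k1 + h2 * k3 + h3 * k2 + h4 * k4"
    define H where "H = h1 * k2 + h2 * k4"
    have \<sigma>: "\<sigma> > 0" using h(3) by (simp add: \<sigma>_def)
    have K: "\<bar>K\<bar> > 0" using h(2) k(2) by (simp add: K_def)
    have K\<sigma>: "K * \<sigma> = h2 * k1 + h4 * k2" using h(2) k(2) by (simp add: K_def \<sigma>_def field_simps)
    \<comment> \<open>Chosen so that \<open>\<bar>t * (K * \<sigma>)\<bar>\<close> exceeds both
      \<open>\<bar>T\<bar>\<close> and \<open>\<bar>T - 2 * \<sigma> * H\<bar>\<close>, the
      remaining terms of the trace at \<open>s = 0\<close> and \<open>s = 2 * \<sigma>\<close>,
      where \<open>\<sigma> - s\<close> is \<open>\<sigma>\<close> and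
      \<open>- \<sigma>\<close>.\<close>
    define t where "t = (\<bar>T\<bar> + \<bar>T - 2 * \<sigma> * H\<bar> + 1) / (\<bar>K\<bar> * \<sigma>)"
    have t: "t \<ge> 0" using \<sigma> by (simp add: t_def)
    have tK: "\<bar>t * (K * \<sigma>)\<bar> = \<bar>T\<bar> + \<bar>T - 2 * \<sigma> * H\<bar> + 1"
    proof -
      have "\<bar>t * (K * \<sigma>)\<bar> = t * (\<bar>K\<bar> * \<sigma>)" using t \<sigma> by (simp add: abs_mult)
      also have "\<dots> = \<bar>T\<bar> + \<bar>T - 2 * \<sigma> * H\<bar> + 1" using K \<sigma> unfolding t_def by simp
      finally show ?thesis .
    qed
    define M where "M s = mat2 1 0 (- s) 1 ** (mat2 h1 h2 h3 h4 ** (mat2 1 0 (- t) 1 ** mat2 k1 k2 k3 k4))" for s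
    have G: "M s \<in> G" if "s \<in> {0..2 * \<sigma>}" for s
      using that t unfolding M_def by (intro mult N h(1) k(1)) auto
    have det: "det (M s) = det (mat2 h1 h2 h3 h4) * det (mat2 k1 k2 k3 k4)" for s
      unfolding M_def det_mul det_mat2[of 1] by simp
    have tr: "M s $ 1 $ 1 + M s $ 2 $ 2 = T - s * H - t * (K * \<sigma>) + t * (s * K)" for s
      unfolding K\<sigma> by (simp add: M_def T_def H_def K_def algebra_simps)
    show ?thesis
    proof (rule trace_path_imp_alternatives[OF _ G det])
      show "continuous_on {0..2 * \<sigma>} (\<lambda>s. M s $ 1 $ 1 + M s $ 2 $ 2)"
        unfolding tr by (intro continuous_intros)
      define X where "X = t * (K * \<sigma>)"
      have "M 0 $ 1 $ 1 + M 0 $ 2 $ 2 = T - X" unfolding tr X_def by simp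
      moreover have "M (2 * \<sigma>) $ 1 $ 1 + M (2 * \<sigma>) $ 2 $ 2 = (T - 2 * \<sigma> * H) + X"
        unfolding tr X_def by (simp add: algebra_simps)
      moreover have "(T - X) * ((T - 2 * \<sigma> * H) + X) < 0"
      proof (cases "X > 0")
        case True
        then have "T - X < 0" "(T - 2 * \<sigma> * H) + X > 0"
          using tK abs_ge_self[of T] abs_ge_minus_self[of "T - 2 * \<sigma> * H"] abs_ge_zero[of T] abs_ge_zero[of "T - 2 * \<sigma> * H"]
          unfolding X_def by linarith+
        then show ?thesis by (rule mult_neg_pos)
      next
        case False
        then have "T - X > 0" "(T - 2 * \<sigma> * H) + X < 0"
          using tK abs_ge_minus_self[of T] abs_ge_self[of "T - 2 * \<sigma> * H"] abs_ge_zero[of T] abs_ge_zero[of "T - 2 * \<sigma> * H"]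
          unfolding X_def by linarith+
        then show ?thesis by (rule mult_pos_neg)
      qed
      ultimately show "(M 0 $ 1 $ 1 + M 0 $ 2 $ 2) * (M (2 * \<sigma>) $ 1 $ 1 + M (2 * \<sigma>) $ 2 $ 2) < 0" by simp
    qed (use \<sigma> in auto)
  qed
qed

end

section \<open>Tangent directions at the identity\<close>

lemma tendsto_difference_quotient:
  assumes "(f has_real_derivative D) (at 0)"
  shows "((\<lambda>h. (1 / h) * (f h - f 0)) \<longlongrightarrow> D) (at_right 0)"
proof -
  have "((\<lambda>h. (f h - f 0) / h) \<longlongrightarrow> D) (at 0)"
    using assms by (simp add: has_field_derivative_iff)
  then have "((\<lambda>h. (f h - f 0) / h) \<longlongrightarrow> D) (at_right 0)"
    by (rule filterlim_mono) (simp_all add: at_le)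
  then show ?thesis by simp
qed

context matrix_semigroup
begin

text \<open>
  For \<open>J ** J = \<kappa> I\<close> the exponential of \<open>t \<omega> J\<close> is a combination of \<open>I\<close> and \<open>J\<close>, with trigonometric,
  linear or hyperbolic coefficients for \<open>\<kappa> = - 1, 0, 1\<close>.
\<close>

lemma one_parameter_flow:
  fixes \<gamma> \<sigma> :: "real \<Rightarrow> real"
  assumes J: "J = mat2 p q r (- p)" "p * p + q * r = \<kappa>"
    and add: "\<And>x y. \<gamma> (x + y) = \<gamma> x * \<gamma> y + \<kappa> * \<sigma> x * \<sigma> y" "\<And>x y. \<sigma> (x + y) = \<sigma> x * \<gamma> y + \<gamma> x * \<sigma> y"
    and init: "\<gamma> 0 = 1" "\<sigma> 0 = 0"
    and deriv: "(\<gamma> has_real_derivative 0) (at 0)" "(\<sigma> has_real_derivative \<omega>) (at 0)"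
    and cont: "continuous_on UNIV \<gamma>" "continuous_on UNIV \<sigma>"
    and unit: "\<And>x. \<gamma> x * \<gamma> x - \<kappa> * \<sigma> x * \<sigma> x = 1"
    and eps: "\<And>n::nat. \<epsilon> n > 0" "\<epsilon> \<longlonglongrightarrow> 0" and Y: "Y \<longlonglongrightarrow> \<omega> *\<^sub>R J"
    and inG: "\<And>n. mat 1 + \<epsilon> n *\<^sub>R Y n \<in> G" and t: "t \<ge> 0"
  shows "\<gamma> t *\<^sub>R mat 1 + \<sigma> t *\<^sub>R J \<in> G"
proof (rule flow[where F = "\<lambda>t. \<gamma> t *\<^sub>R mat 1 + \<sigma> t *\<^sub>R J", OF _ _ _ _ _ t eps Y inG])
  show "\<gamma> 0 *\<^sub>R mat 1 + \<sigma> 0 *\<^sub>R J = mat 1" by (simp add: init)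
  show "\<gamma> (x + y) *\<^sub>R mat 1 + \<sigma> (x + y) *\<^sub>R J = (\<gamma> x *\<^sub>R mat 1 + \<sigma> x *\<^sub>R J) ** (\<gamma> y *\<^sub>R mat 1 + \<sigma> y *\<^sub>R J)" for x y
    unfolding J(1) mat_1_mat2 mat2_scaleR mat2_add mat2_mult mat2_eq_iff add J(2)[symmetric]
    by (simp add: algebra_simps)
  show "continuous_on UNIV (\<lambda>t. \<gamma> t *\<^sub>R mat 1 + \<sigma> t *\<^sub>R J)"
    by (intro continuous_intros cont)
  have "det (\<gamma> t *\<^sub>R mat 1 + \<sigma> t *\<^sub>R J) = \<gamma> t * \<gamma> t - (p * p + q * r) * \<sigma> t * \<sigma> t"
    by (simp add: J(1) mat_1_mat2 algebra_simps)
  then show "0 < det (\<gamma> t *\<^sub>R mat 1 + \<sigma> t *\<^sub>R J)" by (simp add: J(2) unit)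
  have "((\<lambda>h. ((1 / h) * (\<gamma> h - \<gamma> 0)) *\<^sub>R mat 1 + ((1 / h) * (\<sigma> h - \<sigma> 0)) *\<^sub>R J) \<longlongrightarrow> 0 *\<^sub>R mat 1 + \<omega> *\<^sub>R J) (at_right 0)"
    by (intro tendsto_intros tendsto_difference_quotient deriv)
  then show "((\<lambda>h. (1 / h) *\<^sub>R (\<gamma> h *\<^sub>R mat 1 + \<sigma> h *\<^sub>R J - mat 1)) \<longlongrightarrow> \<omega> *\<^sub>R J) (at_right 0)"
    by (simp add: init algebra_simps)
qed

lemma tangent_direction_imp_alternatives:
  assumes eps: "\<And>n::nat. \<epsilon> n > 0" "\<epsilon> \<longlonglongrightarrow> 0" and Y: "Y \<longlonglongrightarrow> mat2 p q r (- p)"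
    and inG: "\<And>n. mat 1 + \<epsilon> n *\<^sub>R Y n \<in> G" and nz: "p \<noteq> 0 \<or> q \<noteq> 0 \<or> r \<noteq> 0"
  shows "alternatives G"
proof -
  define \<delta> where "\<delta> = p * p + q * r"
  \<comment> \<open>The limit direction is \<open>\<omega> *\<^sub>R J\<close>, where
    \<open>J ** J\<close> is the sign of \<open>\<delta>\<close> times the identity. For
    \<open>\<delta> = 0\<close> the value 1 only avoids division by zero.\<close>
  define \<omega> where "\<omega> = (if \<delta> = 0 then 1 else sqrt \<bar>\<delta>\<bar>)"
  have \<omega>: "\<omega> > 0" "\<delta> \<noteq> 0 \<Longrightarrow> \<omega> * \<omega> = \<bar>\<delta>\<bar>" by (auto simp: \<omega>_def)
  define P Q R where "P = p / \<omega>" and "Q = q / \<omega>" and "R = r / \<omega>"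
  define J where J: "J = mat2 P Q R (- P)"
  have pqr: "p = \<omega> * P" "q = \<omega> * Q" "r = \<omega> * R" using \<omega> by (simp_all add: P_def Q_def R_def)
  have JY: "Y \<longlonglongrightarrow> \<omega> *\<^sub>R J" using Y by (simp add: J pqr)
  have \<delta>: "\<delta> = (\<omega> * \<omega>) * (P * P + Q * R)" by (simp add: \<delta>_def pqr algebra_simps)
  consider "\<delta> < 0" | "\<delta> = 0" | "\<delta> > 0" by linarith
  then show ?thesis
  proof cases
    case 1
    then have "\<omega> * \<omega> = - \<delta>" using \<omega>(2) by simp
    with \<delta> have "\<delta> * (P * P + Q * R + 1) = 0" by algebra
    then have \<kappa>: "P * P + Q * R = - 1" using 1 by simp
    have JJ: "J ** J = - mat 1"
    proof -
      have "J ** J = mat2 (P * P + Q * R) 0 0 (P * P + Q * R)" by (simp add: J algebra_simps)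
      then show ?thesis by (simp add: \<kappa> mat_1_mat2 vec_eq_iff forall_2)
    qed
    have pos: "rotation_about J \<theta> \<in> G" if "\<theta> \<ge> 0" for \<theta>
    proof -
      have "cos (\<omega> * (\<theta> / \<omega>)) *\<^sub>R mat 1 + sin (\<omega> * (\<theta> / \<omega>)) *\<^sub>R J \<in> G"
        by (rule one_parameter_flow[where \<gamma> = "\<lambda>t. cos (\<omega> * t)" and \<sigma> = "\<lambda>t. sin (\<omega> * t)", OF J \<kappa> _ _ _ _ _ _ _ _ _ eps JY inG])
          (use that \<omega>(1) in \<open>auto intro!: derivative_eq_intros continuous_intros
            simp: distrib_left cos_add sin_add power2_eq_square[symmetric]\<close>)
      then show ?thesis using \<omega>(1) by (simp add: rotation_about_def)
    qed
    \<comment> \<open>Periodicity turns a negative angle into a nonnegative one.\<close>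
    have "rotation_about J \<theta> \<in> G" for \<theta>
    proof -
      obtain n :: nat where n: "- \<theta> / (2 * pi) \<le> real n" using real_arch_simple by blast
      then have "0 \<le> \<theta> + 2 * pi * real n" by (simp add: field_simps)
      moreover have "rotation_about J (\<theta> + 2 * pi * real n) = rotation_about J \<theta>"
        using cos_int_2pin[of "int n"] sin_int_2pin[of "int n"] by (simp add: rotation_about_def cos_add sin_add)
      ultimately show ?thesis using pos by metis
    qed
    then show ?thesis by (rule rotation_about_imp_alternatives[OF JJ])
  next
    case 2
    then have \<kappa>: "P * P + Q * R = 0" using \<delta> \<omega>(1) by simp
    have inG': "1 *\<^sub>R mat 1 + t *\<^sub>R J \<in> G" if "t \<ge> 0" for t
      by (rule one_parameter_flow[where \<gamma> = "\<lambda>t. 1" and \<sigma> = "\<lambda>t. t", OF J \<kappa> _ _ _ _ _ _ _ _ _ eps JY inG])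
        (use that 2 in \<open>auto intro!: derivative_eq_intros continuous_intros simp: \<omega>_def\<close>)
    \<comment> \<open>The columns of \<open>B\<close> are a vector outside the kernel of
      \<open>J\<close> and minus its image under \<open>J\<close>. The vector is
      \<open>vec2 1 0\<close>, or \<open>vec2 0 1\<close> if \<open>R = 0\<close>.\<close>
    obtain A B where AB: "A ** B = mat 1" "\<And>t. A ** (mat2 1 0 0 1 + t *\<^sub>R J) ** B = mat2 1 0 (- t) 1"
    proof (cases "R = 0")
      case False
      define u where "u = 1 / R"
      have u: "u * R = 1" using False by (simp add: u_def)
      show thesis
      proof (rule that)
        show "mat2 1 (- (P * u)) 0 (- u) ** mat2 1 (- P) 0 (- R) = mat 1"
          unfolding mat_1_mat2 mat2_mult mat2_eq_iff by (intro conjI; (simp add: algebra_simps; fail | use u in algebra))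
        show "mat2 1 (- (P * u)) 0 (- u) ** (mat2 1 0 0 1 + t *\<^sub>R J) ** mat2 1 (- P) 0 (- R) = mat2 1 0 (- t) 1" for t
          unfolding J mat2_scaleR mat2_add mat2_mult mat2_eq_iff
          by (intro conjI; (simp add: algebra_simps; fail | use u \<kappa> in algebra))
      qed
    next
      case True
      then have "P = 0" using \<kappa> by simp
      then have "Q \<noteq> 0" using nz pqr True by auto
      then show thesis using True \<open>P = 0\<close>
        by (intro that[of "mat2 0 1 (- (1 / Q)) 0" "mat2 0 (- Q) 1 0"]) (simp_all add: J mat_1_mat2)
    qed
    interpret conj: matrix_semigroup "(\<lambda>M. A ** M ** B) ` G" by (rule conjugate[OF AB(1)])
    have "alternatives ((\<lambda>M. A ** M ** B) ` G)"
    proof (rule conj.parabolic_flow_imp_alternatives)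
      fix t :: real assume "t \<ge> 0"
      from imageI[OF inG'[OF this], of "\<lambda>M. A ** M ** B"]
      show "mat2 1 0 (- t) 1 \<in> (\<lambda>M. A ** M ** B) ` G" by (simp only: scaleR_one mat_1_mat2 AB(2))
    qed
    then show ?thesis by (rule alternatives_conjugate[OF AB(1)])
  next
    case 3
    then have "\<omega> * \<omega> = \<delta>" using \<omega>(2) by simp
    with \<delta> have "\<delta> * (P * P + Q * R - 1) = 0" by algebra
    then have \<kappa>: "P * P + Q * R = 1" using 3 by simp
    have inG': "cosh t *\<^sub>R mat 1 + sinh t *\<^sub>R J \<in> G" if "t \<ge> 0" for t
    proof -
      have "cosh (\<omega> * (t / \<omega>)) *\<^sub>R mat 1 + sinh (\<omega> * (t / \<omega>)) *\<^sub>R J \<in> G"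
        by (rule one_parameter_flow[where \<gamma> = "\<lambda>t. cosh (\<omega> * t)" and \<sigma> = "\<lambda>t. sinh (\<omega> * t)", OF J \<kappa> _ _ _ _ _ _ _ _ _ eps JY inG])
          (use that \<omega>(1) in \<open>auto intro!: derivative_eq_intros continuous_intros
            simp: distrib_left cosh_add sinh_add cosh_square_eq power2_eq_square[symmetric]\<close>)
      then show ?thesis using \<omega>(1) by simp
    qed
    \<comment> \<open>The columns of \<open>B\<close> are eigenvectors of \<open>J\<close> for 1 and
      -1. The generic choice \<open>(P + 1, R)\<close> and \<open>(P - 1, R)\<close> becomes
      dependent for \<open>R = 0\<close>, where the eigenvectors are found separately.\<close>
    obtain A B where AB: "A ** B = mat 1"
      "\<And>c s. A ** (c *\<^sub>R mat2 1 0 0 1 + s *\<^sub>R J) ** B = mat2 (c + s) 0 0 (c - s)"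
    proof (cases "R = 0")
      case False
      define u where "u = 1 / (2 * R)"
      have u: "2 * u * R = 1" using False by (simp add: u_def)
      show thesis
      proof (rule that)
        show "mat2 (u * R) (u * (1 - P)) (- (u * R)) (u * (P + 1)) ** mat2 (P + 1) (P - 1) R R = mat 1"
          unfolding mat_1_mat2 mat2_mult mat2_eq_iff by (intro conjI; (simp add: algebra_simps; fail | use u in algebra))
        show "mat2 (u * R) (u * (1 - P)) (- (u * R)) (u * (P + 1)) ** (c *\<^sub>R mat2 1 0 0 1 + s *\<^sub>R J) ** mat2 (P + 1) (P - 1) R R
            = mat2 (c + s) 0 0 (c - s)" for c s
          unfolding J mat2_scaleR mat2_add mat2_mult mat2_eq_iff
          by (intro conjI; (simp add: algebra_simps; fail | use u \<kappa> in algebra))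
      qed
    next
      case True
      then have "P * P = 1" using \<kappa> by simp
      then consider "P = 1" | "P = - 1" using square_eq_1_iff by blast
      then show thesis
      proof cases
        case 1
        then show thesis using True
          by (intro that[of "mat2 1 (Q / 2) 0 (1 / 2)" "mat2 1 (- Q) 0 2"]) (simp_all add: J mat_1_mat2 field_simps)
      next
        case 2
        then show thesis using True
          by (intro that[of "mat2 0 (1 / 2) 1 (- (Q / 2))" "mat2 Q 1 2 0"]) (simp_all add: J mat_1_mat2 field_simps)
      qed
    qed
    interpret conj: matrix_semigroup "(\<lambda>M. A ** M ** B) ` G" by (rule conjugate[OF AB(1)])
    have "alternatives ((\<lambda>M. A ** M ** B) ` G)"
    proof (rule conj.hyperbolic_flow_imp_alternatives)
      fix t :: real assume "t \<ge> 0"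
      from imageI[OF inG'[OF this], of "\<lambda>M. A ** M ** B"]
      show "mat2 (exp t) 0 0 (exp (- t)) \<in> (\<lambda>M. A ** M ** B) ` G"
        by (simp only: mat_1_mat2 AB(2) cosh_plus_sinh cosh_minus_sinh)
    qed
    then show ?thesis by (rule alternatives_conjugate[OF AB(1)])
  qed
qed

text \<open>Division by half the trace \<open>\<tau>\<close> makes the deviation from the identity
  exactly traceless. Dividing the deviation further by its size \<open>N / \<tau>\<close> gives
  directions with absolute values of \<open>p, q, r\<close> summing to 1. By compactness a
  subsequence converges, and its limit still has size 1, so it is not zero.\<close>

lemma nondiscrete_imp_alternatives:
  assumes near: "\<And>e. e > 0 \<Longrightarrow> \<exists>a b c d. mat2 a b c d \<in> G \<and> \<bar>a - 1\<bar> < e \<and> \<bar>b\<bar> < e \<and> \<bar>c\<bar> < e \<and> \<bar>d - 1\<bar> < e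
      \<and> (a \<noteq> d \<or> b \<noteq> 0 \<or> c \<noteq> 0)"
  shows "alternatives G"
proof -
  define e where "e n = 1 / (2 * real (Suc n))" for n
  have e: "0 < e n" "e n \<le> 1 / 2" for n by (auto simp: e_def field_simps)
  have "\<forall>n. \<exists>a b c d. mat2 a b c d \<in> G \<and> \<bar>a - 1\<bar> < e n \<and> \<bar>b\<bar> < e n \<and> \<bar>c\<bar> < e n \<and> \<bar>d - 1\<bar> < e n
      \<and> (a \<noteq> d \<or> b \<noteq> 0 \<or> c \<noteq> 0)"
    using near e(1) by blast
  then obtain a b c d where abcd: "\<And>n. mat2 (a n) (b n) (c n) (d n) \<in> G"
    "\<And>n. \<bar>a n - 1\<bar> < e n" "\<And>n. \<bar>b n\<bar> < e n" "\<And>n. \<bar>c n\<bar> < e n" "\<And>n. \<bar>d n - 1\<bar> < e n"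
    "\<And>n. a n \<noteq> d n \<or> b n \<noteq> 0 \<or> c n \<noteq> 0"
    by metis
  define \<tau> where "\<tau> n = (a n + d n) / 2" for n
  define m where "m n = (a n - d n) / 2" for n
  define N where "N n = \<bar>m n\<bar> + \<bar>b n\<bar> + \<bar>c n\<bar>" for n
  have \<tau>: "\<tau> n \<ge> 1 / 2" for n
  proof -
    have "1 - e n < a n" "1 - e n < d n" using abcd(2,5)[of n] by (simp_all add: abs_less_iff)
    then have "1 \<le> a n + d n" using e(2)[of n] by simp
    then show ?thesis by (simp add: \<tau>_def)
  qed
  have N: "N n > 0" for n
    using abcd(6)[of n] unfolding N_def m_def by (smt (verit) divide_eq_0_iff)
  have Ne: "N n \<le> 3 * e n" for n
  proof -
    have "1 - e n < a n" "1 - e n < d n" "a n < 1 + e n" "d n < 1 + e n"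
      using abcd(2,5)[of n] by (simp_all add: abs_less_iff)
    then have "\<bar>m n\<bar> \<le> e n" by (simp add: m_def abs_le_iff)
    then show ?thesis using abcd(3,4)[of n] unfolding N_def by simp
  qed
  define \<epsilon> where "\<epsilon> n = N n / \<tau> n" for n
  have \<epsilon>0: "\<epsilon> n > 0" for n using N[of n] \<tau>[of n] by (simp add: \<epsilon>_def)
  have elim: "e \<longlonglongrightarrow> 0"
  proof -
    have "(\<lambda>n. (1 / 2) * inverse (real (Suc n))) \<longlonglongrightarrow> (1 / 2) * 0"
      by (intro tendsto_intros LIMSEQ_inverse_real_of_nat)
    moreover have "e = (\<lambda>n. (1 / 2) * inverse (real (Suc n)))" by (auto simp: e_def field_simps)
    ultimately show ?thesis by simp
  qed
  have \<epsilon>lim: "\<epsilon> \<longlonglongrightarrow> 0"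
  proof (rule Lim_null_comparison)
    show "\<forall>\<^sub>F n in sequentially. norm (\<epsilon> n) \<le> 6 * e n"
    proof (rule always_eventually, rule allI)
      fix n
      have "\<epsilon> n \<le> N n / (1 / 2)" unfolding \<epsilon>_def using N[of n] \<tau>[of n] by (intro divide_left_mono) auto
      then show "norm (\<epsilon> n) \<le> 6 * e n" using Ne[of n] \<epsilon>0[of n] by simp
    qed
    show "(\<lambda>n. 6 * e n) \<longlonglongrightarrow> 0" using tendsto_mult_right_zero[OF elim] by simp
  qed
  define f where "f n = (m n / N n, b n / N n, c n / N n)" for n
  have bd: "\<bar>x / N n\<bar> \<le> 1" if "\<bar>x\<bar> \<le> N n" for x n
    using that N[of n] by (simp add: abs_divide)
  have "f n \<in> {-1..1} \<times> {-1..1} \<times> {-1..1}" for n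
  proof -
    have "\<bar>m n / N n\<bar> \<le> 1" "\<bar>b n / N n\<bar> \<le> 1" "\<bar>c n / N n\<bar> \<le> 1"
      by (rule bd, simp add: N_def)+
    then show ?thesis unfolding f_def abs_le_iff by auto
  qed
  moreover have "compact ({-1..1} \<times> {-1..1} \<times> {-1..1::real} :: (real \<times> real \<times> real) set)"
    by (intro compact_Times compact_Icc)
  ultimately obtain l and \<rho> :: "nat \<Rightarrow> nat" where l: "strict_mono \<rho>" "(f \<circ> \<rho>) \<longlonglongrightarrow> l"
    unfolding compact_def by metis
  obtain p q r where pqr: "l = (p, q, r)" by (cases l)
  have lims: "(\<lambda>n. m (\<rho> n) / N (\<rho> n)) \<longlonglongrightarrow> p" "(\<lambda>n. b (\<rho> n) / N (\<rho> n)) \<longlonglongrightarrow> q" "(\<lambda>n. c (\<rho> n) / N (\<rho> n)) \<longlonglongrightarrow> r"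
    using tendsto_fst[OF l(2)] tendsto_fst[OF tendsto_snd[OF l(2)]] tendsto_snd[OF tendsto_snd[OF l(2)]]
    by (simp_all add: f_def pqr comp_def)
  show ?thesis
  proof (rule tangent_direction_imp_alternatives)
    show "\<epsilon> (\<rho> n) > 0" for n by (rule \<epsilon>0)
    show "(\<lambda>n. \<epsilon> (\<rho> n)) \<longlonglongrightarrow> 0" using LIMSEQ_subseq_LIMSEQ[OF \<epsilon>lim l(1)] by (simp add: comp_def)
    show "(\<lambda>n. mat2 (m (\<rho> n) / N (\<rho> n)) (b (\<rho> n) / N (\<rho> n)) (c (\<rho> n) / N (\<rho> n)) (- (m (\<rho> n) / N (\<rho> n)))) \<longlonglongrightarrow> mat2 p q r (- p)"
      by (intro tendsto_mat2 tendsto_minus lims)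
    have "mat 1 + \<epsilon> n *\<^sub>R mat2 (m n / N n) (b n / N n) (c n / N n) (- (m n / N n)) = (1 / \<tau> n) *\<^sub>R mat2 (a n) (b n) (c n) (d n)" for n
    proof -
      have "N n \<noteq> 0" "\<tau> n \<noteq> 0" using N[of n] \<tau>[of n] by auto
      moreover have "a n = \<tau> n + m n" "d n = \<tau> n - m n" by (simp_all add: \<tau>_def m_def field_simps)
      ultimately show ?thesis by (simp add: \<epsilon>_def mat_1_mat2 add_divide_distrib diff_divide_distrib)
    qed
    then show "mat 1 + \<epsilon> (\<rho> n) *\<^sub>R mat2 (m (\<rho> n) / N (\<rho> n)) (b (\<rho> n) / N (\<rho> n)) (c (\<rho> n) / N (\<rho> n)) (- (m (\<rho> n) / N (\<rho> n))) \<in> G" for n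
      using scale[OF abcd(1)[of "\<rho> n"], of "1 / \<tau> (\<rho> n)"] \<tau>[of "\<rho> n"] by auto
    have "(\<lambda>n. \<bar>m (\<rho> n) / N (\<rho> n)\<bar> + \<bar>b (\<rho> n) / N (\<rho> n)\<bar> + \<bar>c (\<rho> n) / N (\<rho> n)\<bar>) \<longlonglongrightarrow> \<bar>p\<bar> + \<bar>q\<bar> + \<bar>r\<bar>"
      by (intro tendsto_intros lims)
    moreover have "\<bar>m n / N n\<bar> + \<bar>b n / N n\<bar> + \<bar>c n / N n\<bar> = 1" for n
    proof -
      have "\<bar>N n\<bar> = N n" using N[of n] by simp
      then have "\<bar>m n / N n\<bar> + \<bar>b n / N n\<bar> + \<bar>c n / N n\<bar> = (\<bar>m n\<bar> + \<bar>b n\<bar> + \<bar>c n\<bar>) / N n"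
        by (simp only: abs_divide add_divide_distrib)
      also have "\<dots> = N n / N n" by (simp only: N_def)
      finally have "\<bar>m n / N n\<bar> + \<bar>b n / N n\<bar> + \<bar>c n / N n\<bar> = N n / N n" .
      then show ?thesis using N[of n] by simp
    qed
    ultimately have "(\<lambda>n::nat. 1) \<longlonglongrightarrow> \<bar>p\<bar> + \<bar>q\<bar> + \<bar>r\<bar>" by simp
    then have "\<bar>p\<bar> + \<bar>q\<bar> + \<bar>r\<bar> = 1" by (simp add: LIMSEQ_const_iff)
    then show "p \<noteq> 0 \<or> q \<noteq> 0 \<or> r \<noteq> 0" by auto
  qed
qed

end

section \<open>The action on the Riemann sphere\<close>

text \<open>The point with homogeneous coordinates \<open>x\<close> and \<open>y\<close>; junk at \<open>(0, 0)\<close>.\<close>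

definition proj :: "complex \<Rightarrow> complex \<Rightarrow> complex option" where
  "proj x y = (if y = 0 then None else Some (x / y))"

definition rproj :: "real^2 \<Rightarrow> complex option" where
  "rproj v = proj (of_real (v $ 1)) (of_real (v $ 2))"

lemma proj_cases: obtains x y where "z = proj x y" "x \<noteq> 0 \<or> y \<noteq> 0"
proof (cases z)
  case None
  then show thesis by (intro that[of 1 0]) (simp_all add: proj_def)
next
  case (Some w)
  then show thesis by (intro that[of w 1]) (simp_all add: proj_def)
qed

lemma proj_scale: "k \<noteq> 0 \<Longrightarrow> proj (k * x) (k * y) = proj x y"
  by (simp add: proj_def)

lemma mobius_proj:
  assumes "x \<noteq> 0 \<or> y \<noteq> 0"
  shows "mobius (mat2 a b c d) (proj x y) = proj (of_real a * x + of_real b * y) (of_real c * x + of_real d * y)"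
proof (cases "y = 0")
  case True
  then show ?thesis using assms by (simp add: mobius_def proj_def)
next
  case False
  have "of_real c * (x / y) + of_real d = (of_real c * x + of_real d * y) / y"
    "of_real a * (x / y) + of_real b = (of_real a * x + of_real b * y) / y"
    using False by (simp_all add: field_simps)
  then show ?thesis using False by (simp add: mobius_def proj_def)
qed

lemma mobius_rproj: "v \<noteq> 0 \<Longrightarrow> mobius A (rproj v) = rproj (A *v v)"
proof -
  assume v: "v \<noteq> 0"
  obtain a b c d where A: "A = mat2 a b c d" by (rule mat2_cases)
  obtain x y where "v = vec2 x y" by (rule vec2_cases)
  then show ?thesis using v by (simp add: A rproj_def mobius_proj)
qed

lemma rproj_scaleR: "k \<noteq> 0 \<Longrightarrow> rproj (k *\<^sub>R v) = rproj v"
  using proj_scale[of "of_real k"] by (simp add: rproj_def)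

lemma rproj_eqD: "rproj (vec2 x y) = rproj (vec2 x' y') \<Longrightarrow> x * y' = x' * y"
  unfolding rproj_def proj_def
  by (auto split: if_splits simp: frac_eq_eq simp flip: of_real_divide)

lemma rproj_in_ext_real_line: "rproj v \<in> ext_real_line"
  by (auto simp: rproj_def proj_def ext_real_line_def)

lemma matrix_vector_mult_nonzero:
  fixes A :: "real^2^2" assumes "det A \<noteq> 0" "v \<noteq> 0" shows "A *v v \<noteq> 0"
proof -
  have "invertible A" using assms by (simp add: invertible_det_nz)
  then obtain B where "B ** A = mat 1" by (auto simp: invertible_def)
  then have "B *v (A *v v) = v" by (simp add: matrix_vector_mul_assoc)
  then show ?thesis using assms(2) by auto
qed

lemma mobius_mult:
  assumes "det B \<noteq> 0" shows "mobius (A ** B) = mobius A \<circ> mobius B"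
proof
  fix z
  obtain a b c d where A: "A = mat2 a b c d" by (rule mat2_cases)
  obtain e f g h where B: "B = mat2 e f g h" by (rule mat2_cases)
  obtain x y where z: "z = proj x y" "x \<noteq> 0 \<or> y \<noteq> 0" by (rule proj_cases)
  define u where "u = of_real e * x + of_real f * y"
  define v where "v = of_real g * x + of_real h * y"
  have D: "complex_of_real (e * h - f * g) \<noteq> 0" unfolding of_real_eq_0_iff using assms by (simp add: B)
  \<comment> \<open>The adjugate of \<open>B\<close> recovers \<open>(x, y)\<close> up to the
    determinant, so \<open>(u, v)\<close> is again a valid pair of homogeneous coordinates.\<close>
  have "of_real h * u - of_real f * v = of_real (e * h - f * g) * x"
    "of_real e * v - of_real g * u = of_real (e * h - f * g) * y"
    by (simp_all add: u_def v_def algebra_simps)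
  then have uv: "u \<noteq> 0 \<or> v \<noteq> 0" using D z(2) by auto
  have "mobius (A ** B) z = proj (of_real a * u + of_real b * v) (of_real c * u + of_real d * v)"
    unfolding A B z(1) mat2_mult mobius_proj[OF z(2)] by (simp add: u_def v_def algebra_simps)
  also have "\<dots> = mobius A (mobius B z)"
    unfolding A B z(1) mobius_proj[OF z(2)] u_def[symmetric] v_def[symmetric] mobius_proj[OF uv] ..
  finally show "mobius (A ** B) z = (mobius A \<circ> mobius B) z" by simp
qed

lemma mobius_scaleR: "k \<noteq> 0 \<Longrightarrow> mobius (k *\<^sub>R A) = mobius A"
proof
  fix z assume k: "k \<noteq> 0"
  obtain a b c d where A: "A = mat2 a b c d" by (rule mat2_cases)
  obtain x y where z: "z = proj x y" "x \<noteq> 0 \<or> y \<noteq> 0" by (rule proj_cases)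
  have "mobius (k *\<^sub>R A) z = proj (of_real k * (of_real a * x + of_real b * y)) (of_real k * (of_real c * x + of_real d * y))"
    unfolding A z(1) mat2_scaleR mobius_proj[OF z(2)] by (simp add: algebra_simps)
  also have "\<dots> = mobius A z"
    using k by (simp add: proj_scale A z(1) mobius_proj[OF z(2)])
  finally show "mobius (k *\<^sub>R A) z = mobius A z" .
qed

lemma mobius_one: "mobius (mat 1) = id"
proof
  fix z show "mobius (mat 1) z = id z"
    by (cases z) (simp_all add: mobius_def mat_1_mat2)
qed

lemma mobius_eq_id_iff:
  assumes "a * d - b * c \<noteq> 0"
  shows "mobius (mat2 a b c d) = id \<longleftrightarrow> b = 0 \<and> c = 0 \<and> a = d"
proof
  assume id: "mobius (mat2 a b c d) = id"
  have "c = 0" using fun_cong[OF id, of None] by (simp add: mobius_def split: if_splits)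
  moreover have "d \<noteq> 0" using assms \<open>c = 0\<close> by auto
  moreover have "b = 0" using fun_cong[OF id, of "Some 0"] calculation by (simp add: mobius_def)
  moreover have "a = d" using fun_cong[OF id, of "Some 1"] calculation by (simp add: mobius_def)
  ultimately show "b = 0 \<and> c = 0 \<and> a = d" by simp
next
  assume e: "b = 0 \<and> c = 0 \<and> a = d"
  then have "mat2 a b c d = a *\<^sub>R mat 1" "a \<noteq> 0" using assms by (auto simp: mat_1_mat2)
  then show "mobius (mat2 a b c d) = id" by (simp add: mobius_scaleR mobius_one)
qed

text \<open>Composing with the adjugate \<open>C\<close> of \<open>B\<close> reduces the claim to
  the kernel of \<open>mobius\<close>: \<open>C ** A\<close> acts as the identity, so it is
  scalar.\<close>

lemma mobius_eqD:
  assumes eq: "mobius A = mobius B" and "det A \<noteq> 0" "det B \<noteq> 0"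
  shows "\<exists>k. k \<noteq> 0 \<and> A = k *\<^sub>R B"
proof -
  obtain a b c d where A: "A = mat2 a b c d" by (rule mat2_cases)
  obtain e f g h where B: "B = mat2 e f g h" by (rule mat2_cases)
  define D where "D = e * h - f * g"
  have D: "D \<noteq> 0" using assms(3) by (simp add: B D_def)
  define C where "C = mat2 h (- f) (- g) e"
  have CB: "C ** B = D *\<^sub>R mat 1" by (simp add: C_def B D_def mat_1_mat2 algebra_simps)
  have BC: "B ** C = D *\<^sub>R mat 1" by (simp add: C_def B D_def mat_1_mat2 algebra_simps)
  have "mobius (C ** A) = mobius (C ** B)"
    using assms by (simp add: mobius_mult)
  also have "\<dots> = id" unfolding CB using D by (simp add: mobius_scaleR mobius_one)
  finally have id: "mobius (C ** A) = id" .
  obtain p q r s where CA: "C ** A = mat2 p q r s" by (rule mat2_cases)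
  have "det (C ** A) = D * det A" by (simp add: det_mul C_def D_def mult.commute)
  then have det: "p * s - q * r \<noteq> 0" using D assms(2) by (simp add: CA)
  have "q = 0 \<and> r = 0 \<and> p = s" using id mobius_eq_id_iff[OF det] by (simp add: CA)
  then have CA': "C ** A = p *\<^sub>R mat 1" and p: "p \<noteq> 0" using det by (auto simp: CA mat_1_mat2)
  have "D *\<^sub>R A = (B ** C) ** A" by (simp add: BC A mat_1_mat2)
  also have "\<dots> = B ** (C ** A)" by (simp add: matrix_mul_assoc)
  also have "\<dots> = p *\<^sub>R B" by (simp add: CA' B mat_1_mat2 mult.commute)
  finally have "(1 / D) *\<^sub>R (D *\<^sub>R A) = (1 / D) *\<^sub>R (p *\<^sub>R B)" by simp
  then have "A = (p / D) *\<^sub>R B" using D by simp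
  then show ?thesis using p D by (intro exI[of _ "p / D"]) simp
qed

section \<open>Projected cones as closed intervals\<close>

lemma continuous_map_proj:
  fixes u v :: "real \<Rightarrow> complex"
  assumes cont: "continuous_on I u" "continuous_on I v" and nz: "\<And>t. t \<in> I \<Longrightarrow> u t \<noteq> 0 \<or> v t \<noteq> 0"
  shows "continuous_map (top_of_set I) riemann_sphere (\<lambda>t. proj (u t) (v t))"
proof -
  have affine: "openin (top_of_set I) {t \<in> I. v t \<noteq> 0 \<and> u t / v t \<in> W}" if W: "open W" for W
  proof -
    define I0 where "I0 = {t \<in> I. v t \<noteq> 0}"
    have "I0 = I \<inter> v -` (- {0})" by (auto simp: I0_def)
    then have "openin (top_of_set I) I0"
      using continuous_openin_preimage_gen[OF cont(2), of "- {0}"] by (simp add: open_Compl)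
    moreover have "continuous_on I0 (\<lambda>t. u t / v t)"
      by (intro continuous_intros continuous_on_subset[OF cont(1)] continuous_on_subset[OF cont(2)]) (auto simp: I0_def)
    then have "openin (top_of_set I0) (I0 \<inter> (\<lambda>t. u t / v t) -` W)"
      using W by (rule continuous_openin_preimage_gen)
    moreover have "I0 \<inter> (\<lambda>t. u t / v t) -` W = {t \<in> I. v t \<noteq> 0 \<and> u t / v t \<in> W}" by (auto simp: I0_def)
    ultimately show ?thesis by (metis openin_trans)
  qed
  have "openin (top_of_set I) {t \<in> I. proj (u t) (v t) \<in> U}" if "openin riemann_sphere U" for U
  proof -
    from that consider (finite) W where "open W" "U = Some ` W"
      | (infinity) C where "compact C" "U = insert None (Some ` (- C))"
      by (auto simp: riemann_sphere_def openin_Alexandroff_compactification Compl_eq_Diff_UNIV)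
    then show ?thesis
    proof cases
      case finite
      have "{t \<in> I. proj (u t) (v t) \<in> U} = {t \<in> I. v t \<noteq> 0 \<and> u t / v t \<in> W}"
        by (auto simp: finite(2) proj_def)
      then show ?thesis using affine[OF finite(1)] by simp
    next
      case infinity
      obtain M where M: "M > 0" "\<And>w. w \<in> C \<Longrightarrow> norm w \<le> M"
        using compact_imp_bounded[OF infinity(1)] by (auto simp: bounded_pos)
      \<comment> \<open>Near infinity the quotient is tested without dividing:
        \<open>norm (u t) > M * norm (v t)\<close> is an open condition, includes the zeros of
        \<open>v\<close>, and keeps the point outside \<open>C\<close>.\<close>
      have "continuous_on I (\<lambda>t. norm (u t) - M * norm (v t))" by (intro continuous_intros cont)
      then have "openin (top_of_set I) (I \<inter> (\<lambda>t. norm (u t) - M * norm (v t)) -` {0<..})"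
        by (rule continuous_openin_preimage_gen) simp
      moreover have "openin (top_of_set I) {t \<in> I. v t \<noteq> 0 \<and> u t / v t \<in> - C}"
        by (rule affine) (simp add: compact_imp_closed infinity(1) open_Compl)
      ultimately have "openin (top_of_set I) ((I \<inter> (\<lambda>t. norm (u t) - M * norm (v t)) -` {0<..}) \<union> {t \<in> I. v t \<noteq> 0 \<and> u t / v t \<in> - C})"
        by (rule openin_Un)
      also have "(I \<inter> (\<lambda>t. norm (u t) - M * norm (v t)) -` {0<..}) \<union> {t \<in> I. v t \<noteq> 0 \<and> u t / v t \<in> - C}
          = {t \<in> I. proj (u t) (v t) \<in> U}" (is "?L = ?R")
      proof (intro set_eqI iffI)
        fix t assume "t \<in> ?L"
        then consider "t \<in> I" "v t \<noteq> 0" "u t / v t \<notin> C" | "t \<in> I" "v t = 0"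
          | "t \<in> I" "v t \<noteq> 0" "norm (u t) > M * norm (v t)" by auto
        then show "t \<in> ?R"
        proof cases
          case 3
          have "u t / v t \<notin> C"
          proof
            assume "u t / v t \<in> C"
            from M(2)[OF this] 3 show False by (simp add: norm_divide pos_divide_le_eq)
          qed
          then show ?thesis using 3 by (simp add: proj_def infinity(2))
        qed (auto simp: proj_def infinity(2))
      next
        fix t assume "t \<in> ?R"
        then show "t \<in> ?L" using nz by (auto simp: proj_def infinity(2) split: if_splits)
      qed
      finally show ?thesis .
    qed
  qed
  then show ?thesis
    unfolding continuous_map_def by (auto simp: riemann_sphere_def notin_range_Some)
qed

lemma Hausdorff_riemann_sphere: "Hausdorff_space riemann_sphere"
proof -
  have "locally_compact_space (euclidean :: complex topology)"
    unfolding locally_compact_space_def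
  proof
    fix x :: complex
    show "\<exists>U K. openin euclidean U \<and> compactin euclidean K \<and> x \<in> U \<and> U \<subseteq> K"
      by (intro exI[of _ "ball x 1"] exI[of _ "cball x 1"]) (simp add: ball_subset_cball)
  qed
  then show ?thesis by (simp add: riemann_sphere_def Hausdorff_space_Alexandroff_compactification)
qed

text \<open>After scaling to \<open>x + y = 1\<close> the projected cone is a path joining its two
  edges, hence compact and connected; compactness gives closedness in the Hausdorff sphere.\<close>

lemma closed_interval_cone:
  assumes ind: "p * t - q * r \<noteq> (0::real)"
  shows "closed_interval ((\<lambda>(x, y). rproj (vec2 (p * x + q * y) (r * x + t * y))) ` {(x, y). x \<ge> 0 \<and> y \<ge> 0 \<and> (x, y) \<noteq> (0, 0)})"
    (is "closed_interval ?J")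
proof -
  define \<gamma> where "\<gamma> s = rproj (vec2 (p * s + q * (1 - s)) (r * s + t * (1 - s)))" for s
  have nz: "p * x + q * y \<noteq> 0 \<or> r * x + t * y \<noteq> 0" if "(x, y) \<noteq> (0, 0)" for x y
  proof (rule ccontr)
    assume "\<not> ?thesis"
    then have "(p * t - q * r) * x = 0" "(p * t - q * r) * y = 0" by algebra+
    then show False using ind that by simp
  qed
  have "continuous_map (top_of_set {0..1}) riemann_sphere \<gamma>"
    unfolding \<gamma>_def rproj_def vec2_nth
  proof (rule continuous_map_proj)
    fix s :: real
    show "of_real (p * s + q * (1 - s)) \<noteq> (0::complex) \<or> of_real (r * s + t * (1 - s)) \<noteq> (0::complex)"
      unfolding of_real_eq_0_iff by (rule nz) auto
  qed (intro continuous_intros)+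
  moreover have "compactin (top_of_set {0..1}) {0..1::real}" "connectedin (top_of_set {0..1}) {0..1::real}"
    by (simp_all add: compactin_subtopology connectedin_subtopology)
  ultimately have cc: "compactin riemann_sphere (\<gamma> ` {0..1})" "connectedin riemann_sphere (\<gamma> ` {0..1})"
    using image_compactin connectedin_continuous_map_image by blast+
  have J: "?J = \<gamma> ` {0..1}"
  proof (intro equalityI subsetI)
    fix z assume "z \<in> ?J"
    then obtain x y where xy: "x \<ge> 0" "y \<ge> 0" "(x, y) \<noteq> (0, 0)"
      "z = rproj (vec2 (p * x + q * y) (r * x + t * y))" by auto
    then have s: "x + y > 0" by (auto simp: add_pos_nonneg add_nonneg_pos less_le)
    have "1 - x / (x + y) = y / (x + y)" using s by (simp add: field_simps)
    then have "\<gamma> (x / (x + y)) = rproj ((1 / (x + y)) *\<^sub>R vec2 (p * x + q * y) (r * x + t * y))"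
      by (simp add: \<gamma>_def add_divide_distrib)
    also have "\<dots> = z" by (subst rproj_scaleR) (use s xy(4) in simp_all)
    finally have "z = \<gamma> (x / (x + y))" by simp
    moreover have "x / (x + y) \<in> {0..1}" using xy s by (simp add: divide_le_eq_1)
    ultimately show "z \<in> \<gamma> ` {0..1}" by blast
  next
    fix z assume "z \<in> \<gamma> ` {0..1}"
    then obtain s where "s \<in> {0..1}" "z = \<gamma> s" by blast
    then show "z \<in> ?J" by (intro image_eqI[of _ _ "(s, 1 - s)"]) (auto simp: \<gamma>_def)
  qed
  have sub: "\<gamma> ` {0..1} \<subseteq> ext_real_line" by (auto simp: \<gamma>_def rproj_in_ext_real_line)
  have "closedin riemann_sphere (\<gamma> ` {0..1})"
    using compactin_imp_closedin[OF Hausdorff_riemann_sphere cc(1)] .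
  then have "closedin (subtopology riemann_sphere ext_real_line) (\<gamma> ` {0..1})"
    using sub by (rule closedin_subset_topspace)
  moreover have "connectedin (subtopology riemann_sphere ext_real_line) (\<gamma> ` {0..1})"
    using cc(2) sub by (simp add: connectedin_subtopology)
  moreover have "\<not> is_singleton (\<gamma> ` {0..1})"
  proof
    assume "is_singleton (\<gamma> ` {0..1})"
    then have "\<gamma> 0 = \<gamma> 1" by (auto simp: is_singleton_def) (metis atLeastAtMost_iff imageI order_refl singletonD zero_le_one)
    then have "q * r = p * t" unfolding \<gamma>_def by (intro rproj_eqD) simp
    then show False using ind by simp
  qed
  moreover have "\<gamma> ` {0..1} \<noteq> ext_real_line"
  proof
    assume "\<gamma> ` {0..1} = ext_real_line"
    \<comment> \<open>The difference of the edges has coordinates \<open>(1, - 1)\<close> relative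
      to the cone, so no nonzero multiple of it lies in the cone.\<close>
    then have "rproj (vec2 (p - q) (r - t)) \<in> \<gamma> ` {0..1}" using rproj_in_ext_real_line by blast
    then obtain s where "s \<in> {0..1}" "rproj (vec2 (p - q) (r - t)) = \<gamma> s" by blast
    then have "(p - q) * (r * s + t * (1 - s)) = (p * s + q * (1 - s)) * (r - t)"
      unfolding \<gamma>_def by (intro rproj_eqD)
    then have "p * t - q * r = 0" by algebra
    then show False using ind by simp
  qed
  ultimately show ?thesis unfolding J closed_interval_def by auto
qed

section \<open>From transformations to a closed matrix semigroup\<close>

definition lift_closure :: "(complex option \<Rightarrow> complex option) set \<Rightarrow> (real^2^2) set" where
  "lift_closure S = {A. det A > 0 \<and> A \<in> closure {B. det B > 0 \<and> mobius B \<in> S}}"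

lemma det_scaleR_2: "det (k *\<^sub>R A) = k\<^sup>2 * det A" for A :: "real^2^2"
proof -
  obtain a b c d where "A = mat2 a b c d" by (rule mat2_cases)
  then show ?thesis by (simp add: power2_eq_square algebra_simps)
qed

lemma closure_limitI:
  fixes X :: "nat \<Rightarrow> 'a::metric_space"
  assumes "X \<longlonglongrightarrow> A" "\<And>n. X n \<in> T" shows "A \<in> closure T"
  using assms by (auto simp: closure_sequential)

lemma lift_closureI: "det A > 0 \<Longrightarrow> mobius A \<in> S \<Longrightarrow> A \<in> lift_closure S"
  by (simp add: lift_closure_def closure_subset[THEN subsetD])

lemma lift_cases:
  assumes "mobius_semigroup S" "f \<in> S"
  obtains A where "det A > 0" "f = mobius A" "A \<in> lift_closure S"
proof -
  have "f \<in> mobius_group" using assms unfolding mobius_semigroup_def by blast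
  then obtain A where "det A > 0" "f = mobius A" unfolding mobius_group_def by blast
  then show thesis using assms(2) by (intro that lift_closureI) auto
qed

text \<open>The conditions defining \<open>V\<close> are invariant under nonzero scalars, so
  \<open>V\<close> is the full preimage of its image under \<open>mobius\<close>, and this image is
  open in the quotient topology. Dividing a representative by its first entry turns the conditions
  into closeness to the identity matrix.\<close>

lemma near_identity:
  assumes nd: "\<not> semidiscrete S" and e: "e > 0"
  shows "\<exists>a b c d. det (mat2 a b c d) > 0 \<and> mobius (mat2 a b c d) \<in> S \<and>
      \<bar>a - 1\<bar> < e \<and> \<bar>b\<bar> < e \<and> \<bar>c\<bar> < e \<and> \<bar>d - 1\<bar> < e \<and> (a \<noteq> d \<or> b \<noteq> 0 \<or> c \<noteq> 0)"
proof -
  define V where "V = {A :: real^2^2. det A > 0 \<and> \<bar>A $ 1 $ 2\<bar> < e * \<bar>A $ 1 $ 1\<bar> \<and> \<bar>A $ 2 $ 1\<bar> < e * \<bar>A $ 1 $ 1\<bar>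
      \<and> \<bar>A $ 2 $ 2 - A $ 1 $ 1\<bar> < e * \<bar>A $ 1 $ 1\<bar>}"
  have scale: "k *\<^sub>R A \<in> V" if A: "A \<in> V" and k: "k \<noteq> 0" for k A
  proof -
    have l: "\<bar>k * x\<bar> < e * \<bar>k * y\<bar> \<longleftrightarrow> \<bar>x\<bar> < e * \<bar>y\<bar>" for x y
      using k by (simp add: abs_mult mult.left_commute)
    then show ?thesis using A k unfolding V_def mem_Collect_eq
      by (simp add: l det_scaleR_2 right_diff_distrib[symmetric])
  qed
  have "{A. det A > 0 \<and> mobius A \<in> mobius ` V} = V"
  proof (intro equalityI subsetI)
    fix A assume "A \<in> {A. det A > 0 \<and> mobius A \<in> mobius ` V}"
    then obtain B where B: "det A > 0" "mobius A = mobius B" "B \<in> V" by blast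
    then have "det B > 0" by (simp add: V_def)
    with B obtain k where "k \<noteq> 0" "A = k *\<^sub>R B" using mobius_eqD[OF B(2)] by auto
    then show "A \<in> V" using scale B(3) by blast
  qed (auto simp: V_def)
  moreover have "open V"
    unfolding V_def det_2 by (intro open_Collect_conj open_Collect_less continuous_intros)
  ultimately have open_V: "openin mobius_topology (mobius ` V)"
    by (auto simp: openin_mobius_topology V_def mobius_group_def)
  have "mat 1 \<in> V" using e by (simp add: V_def mat_1_mat2)
  then have id: "id \<in> mobius ` V" using mobius_one by (metis imageI)
  from nd obtain f where f: "f \<noteq> id" "f \<in> S" "f \<in> mobius ` V"
    using id open_V unfolding semidiscrete_def in_derived_set_of by auto
  then obtain A where A: "A \<in> V" "f = mobius A" by blast
  obtain a b c d where Aeq: "A = mat2 a b c d" by (rule mat2_cases)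
  have V: "a * d - b * c > 0" "\<bar>b\<bar> < e * \<bar>a\<bar>" "\<bar>c\<bar> < e * \<bar>a\<bar>" "\<bar>d - a\<bar> < e * \<bar>a\<bar>"
    using A(1) by (simp_all add: V_def Aeq)
  have a: "a \<noteq> 0" using V(2) by auto
  have "mobius (mat2 a b c d) \<noteq> id" using f A by (simp add: Aeq)
  then have ns: "a \<noteq> d \<or> b \<noteq> 0 \<or> c \<noteq> 0" using mobius_eq_id_iff[of a d b c] V(1) by auto
  define k where "k = 1 / a"
  have k: "k \<noteq> 0" using a by (simp add: k_def)
  have kM: "mat2 1 (b / a) (c / a) (d / a) = k *\<^sub>R A" using a by (simp add: Aeq k_def)
  have div: "\<bar>x / a\<bar> < e \<longleftrightarrow> \<bar>x\<bar> < e * \<bar>a\<bar>" for x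
    using a by (simp add: abs_divide pos_divide_less_eq)
  have "d / a - 1 = (d - a) / a" using a by (simp add: field_simps)
  then have "\<bar>d / a - 1\<bar> < e" using V(4) div[of "d - a"] by simp
  moreover have "det (k *\<^sub>R A) > 0" using scale[OF A(1) k] by (simp add: V_def)
  moreover have "mobius (k *\<^sub>R A) \<in> S" using f A k by (simp add: mobius_scaleR)
  moreover have "1 \<noteq> d / a \<or> b / a \<noteq> 0 \<or> c / a \<noteq> 0" using ns a by auto
  ultimately show ?thesis
    using V e div unfolding kM[symmetric]
    by (intro exI[of _ 1] exI[of _ "b / a"] exI[of _ "c / a"] exI[of _ "d / a"]) simp
qed

lemma matrix_semigroup_lift_closure:
  assumes S: "mobius_semigroup S" and nd: "\<not> semidiscrete S"
  shows "matrix_semigroup (lift_closure S)"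
proof
  define T where "T = {B. det B > 0 \<and> mobius B \<in> S}"
  have lift: "A \<in> lift_closure S \<longleftrightarrow> det A > 0 \<and> A \<in> closure T" for A
    by (simp add: lift_closure_def T_def)
  \<comment> \<open>The closure of a semigroup need not contain the identity; here it does because
    the identity is an accumulation point.\<close>
  show "mat 1 \<in> lift_closure S"
  proof -
    have "\<forall>n. \<exists>a b c d. mat2 a b c d \<in> T \<and> \<bar>a - 1\<bar> < inverse (real (Suc n)) \<and> \<bar>b\<bar> < inverse (real (Suc n))
        \<and> \<bar>c\<bar> < inverse (real (Suc n)) \<and> \<bar>d - 1\<bar> < inverse (real (Suc n))"
    proof
      fix n
      have "inverse (real (Suc n)) > 0" by simp
      from near_identity[OF nd this] show "\<exists>a b c d. mat2 a b c d \<in> T \<and> \<bar>a - 1\<bar> < inverse (real (Suc n)) \<and> \<bar>b\<bar> < inverse (real (Suc n))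
        \<and> \<bar>c\<bar> < inverse (real (Suc n)) \<and> \<bar>d - 1\<bar> < inverse (real (Suc n))"
        unfolding T_def by blast
    qed
    then obtain a b c d where T: "\<And>n. mat2 (a n) (b n) (c n) (d n) \<in> T"
      and lt: "\<And>n. \<bar>a n - 1\<bar> < inverse (real (Suc n))" "\<And>n. \<bar>b n\<bar> < inverse (real (Suc n))"
        "\<And>n. \<bar>c n\<bar> < inverse (real (Suc n))" "\<And>n. \<bar>d n - 1\<bar> < inverse (real (Suc n))"
      by metis
    have lim: "x \<longlonglongrightarrow> y" if "\<And>n. \<bar>x n - y\<bar> < inverse (real (Suc n))" for x and y :: real
    proof (rule LIM_zero_cancel, rule Lim_null_comparison[OF _ LIMSEQ_inverse_real_of_nat])
      show "\<forall>\<^sub>F n in sequentially. norm (x n - y) \<le> inverse (real (Suc n))"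
        by (rule always_eventually) (metis less_imp_le real_norm_def that)
    qed
    have "(\<lambda>n. mat2 (a n) (b n) (c n) (d n)) \<longlonglongrightarrow> mat2 1 0 0 1"
      by (intro tendsto_mat2 lim) (simp_all only: lt diff_zero)
    from this T have "mat 1 \<in> closure T" unfolding mat_1_mat2 by (rule closure_limitI)
    then show ?thesis by (simp add: lift mat_1_mat2)
  qed
  show "det A > 0" if "A \<in> lift_closure S" for A using that by (simp add: lift)
  show "A ** B \<in> lift_closure S" if A: "A \<in> lift_closure S" and B: "B \<in> lift_closure S" for A B
  proof -
    obtain X Y where X: "\<And>n. X n \<in> T" "X \<longlonglongrightarrow> A" and Y: "\<And>n. Y n \<in> T" "Y \<longlonglongrightarrow> B"
      using A B unfolding lift closure_sequential by blast
    have "(\<lambda>n. X n ** Y n) \<longlonglongrightarrow> A ** B"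
      unfolding matrix_matrix_mult_def
      by (intro vec_tendstoI) (simp, intro tendsto_intros tendsto_vec_nth X(2) Y(2))
    then have "A ** B \<in> closure T"
    proof (rule closure_limitI)
      fix n
      have "det (X n) > 0" "det (Y n) > 0" "mobius (X n) \<in> S" "mobius (Y n) \<in> S"
        using X(1)[of n] Y(1)[of n] by (simp_all add: T_def)
      then show "X n ** Y n \<in> T"
        using S by (simp add: T_def det_mul mobius_mult mobius_semigroup_def)
    qed
    moreover have "det (A ** B) > 0" using A B by (simp add: det_mul lift)
    ultimately show ?thesis by (simp add: lift)
  qed
  show "c *\<^sub>R A \<in> lift_closure S" if A: "A \<in> lift_closure S" and c: "c \<noteq> 0" for A c
  proof -
    obtain X where X: "\<And>n. X n \<in> T" "X \<longlonglongrightarrow> A"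
      using A unfolding lift closure_sequential by blast
    have "(\<lambda>n. c *\<^sub>R X n) \<longlonglongrightarrow> c *\<^sub>R A" by (intro tendsto_intros X(2))
    then have "c *\<^sub>R A \<in> closure T"
    proof (rule closure_limitI)
      show "c *\<^sub>R X n \<in> T" for n
        using X(1)[of n] c by (simp add: T_def det_scaleR_2 mobius_scaleR)
    qed
    moreover have "det (c *\<^sub>R A) > 0" using A c by (simp add: det_scaleR_2 lift)
    ultimately show ?thesis by (simp add: lift)
  qed
  show "A \<in> lift_closure S" if A: "A \<in> closure (lift_closure S)" and d: "det A > 0" for A
  proof -
    have "closure (lift_closure S) \<subseteq> closure T"
      by (rule closure_minimal) (auto simp: lift)
    then show ?thesis using A d by (auto simp: lift)
  qed
qed

section \<open>From the matrix alternatives back to the semigroup\<close>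

lemma finite_real_orbit_imp_elementary:
  assumes S: "mobius_semigroup S" and "finite_real_orbit (lift_closure S)"
  shows "elementary S"
proof -
  obtain v w where vw: "v \<noteq> 0" "w \<noteq> 0"
    and orb: "\<And>A. A \<in> lift_closure S \<Longrightarrow> \<exists>c. A *v v = c *\<^sub>R v \<or> A *v v = c *\<^sub>R w"
    using assms(2) unfolding finite_real_orbit_def by blast
  have "(\<lambda>f. f (rproj v)) ` S \<subseteq> {rproj v, rproj w}"
  proof (rule image_subsetI)
    fix f assume "f \<in> S"
    with S obtain A where A: "det A > 0" "f = mobius A" "A \<in> lift_closure S" by (rule lift_cases)
    obtain c where c: "A *v v = c *\<^sub>R v \<or> A *v v = c *\<^sub>R w" using orb[OF A(3)] by blast
    have "A *v v \<noteq> 0" using A(1) vw(1) by (intro matrix_vector_mult_nonzero) auto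
    then have "c \<noteq> 0" using c by auto
    have "f (rproj v) = rproj (A *v v)" using A(2) vw(1) by (simp add: mobius_rproj)
    also have "\<dots> \<in> {rproj v, rproj w}" using c rproj_scaleR[OF \<open>c \<noteq> 0\<close>] by auto
    finally show "f (rproj v) \<in> {rproj v, rproj w}" .
  qed
  then have "finite ((\<lambda>f. f (rproj v)) ` S)" by (rule finite_subset) simp
  then show ?thesis
    unfolding elementary_def ext_upper_half_plane_def using rproj_in_ext_real_line by blast
qed

text \<open>\<open>X\<close> acts as an elliptic involution with a single fixed point in the
  half-plane. Whatever commutes with it must fix this point, so \<open>S\<close> has an orbit with
  one element.\<close>

lemma commutes_with_rotation_imp_elementary:
  assumes S: "mobius_semigroup S" and "commutes_with_rotation (lift_closure S)"
  shows "elementary S"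
proof -
  obtain X where X: "X ** X = - mat 1" and com: "\<And>A. A \<in> lift_closure S \<Longrightarrow> A ** X = X ** A"
    using assms(2) unfolding commutes_with_rotation_def by blast
  obtain p q r where pqr: "X = mat2 p q r (- p)" "p * p + q * r = - 1" "r \<noteq> 0"
    by (rule mat2_square_eq_minus_1[OF X])
  \<comment> \<open>The fixed point equation of \<open>X\<close> is
    \<open>r z^2 - 2 p z - q = 0\<close>, with roots \<open>(p + \<i>) / r\<close> and
    \<open>(p - \<i>) / r\<close>. The absolute value selects the root in the upper half-plane for
    either sign of \<open>r\<close>.\<close>
  define z where "z = Complex (p / r) (1 / \<bar>r\<bar>)"
  have Imz: "Im z > 0" using pqr(3) by (simp add: z_def)
  have z: "of_real r * z * z - 2 * of_real p * z - of_real q = 0"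
  proof -
    have "(of_real r * z - of_real p) = \<i> * of_real (sgn r)"
      using pqr(3) by (simp add: z_def complex_eq_iff sgn_if)
    then have "(of_real r * z - of_real p)\<^sup>2 = - 1"
      using pqr(3) by (auto simp: power_mult_distrib sgn_if)
    moreover have "of_real q * of_real r = - 1 - of_real p * complex_of_real p"
      using pqr(2) by (metis add_diff_cancel_left' of_real_1 of_real_add of_real_diff of_real_minus of_real_mult)
    ultimately have "of_real r * (of_real r * z * z - 2 * of_real p * z - of_real q) = 0"
      by algebra
    then show ?thesis using pqr(3) by simp
  qed
  have fix_z: "f (Some z) = Some z" if "f \<in> S" for f
  proof -
    from S that obtain A where A: "det A > 0" "f = mobius A" "A \<in> lift_closure S" by (rule lift_cases)
    obtain a b c d where Aeq: "A = mat2 a b c d" by (rule mat2_cases)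
    have e: "b * r = q * c" "c * p + d * r = r * a - p * c"
      using com[OF A(3)] by (simp_all add: Aeq pqr(1))
    have nz: "of_real c * z + of_real d \<noteq> 0"
    proof
      assume 0: "of_real c * z + of_real d = 0"
      have "Im (of_real c * z + of_real d) = 0" by (simp only: 0 zero_complex.sel)
      then have "c * Im z = 0" by simp
      then have "c = 0" using Imz by simp
      then have "d = 0" using 0 by simp
      then show False using A(1) \<open>c = 0\<close> by (simp add: Aeq)
    qed
    \<comment> \<open>Commutation makes the fixed point polynomial of \<open>A\<close>, multiplied
      by \<open>r\<close>, equal to \<open>c\<close> times that of \<open>X\<close>.\<close>
    have "of_real r * (of_real a * z + of_real b - z * (of_real c * z + of_real d))
        = of_real (r * a - d * r) * z + of_real (b * r) - of_real c * (of_real r * z * z)"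
      by (simp add: algebra_simps)
    also have "of_real r * z * z = 2 * of_real p * z + of_real q" using z by (simp add: algebra_simps)
    also have "r * a - d * r = 2 * p * c" using e(2) by (simp add: algebra_simps)
    also have "of_real (2 * p * c) * z + of_real (b * r) - of_real c * (2 * of_real p * z + of_real q) = 0"
      unfolding e(1) by (simp add: algebra_simps)
    finally have "of_real a * z + of_real b = z * (of_real c * z + of_real d)" using pqr(3) by simp
    then have "(of_real a * z + of_real b) / (of_real c * z + of_real d) = z" using nz by simp
    then show ?thesis using nz by (simp add: A(2) Aeq mobius_def)
  qed
  have "(\<lambda>f. f (Some z)) ` S \<subseteq> {Some z}" using fix_z by auto
  then have "finite ((\<lambda>f. f (Some z)) ` S)" by (rule finite_subset) simp
  then show ?thesis
    unfolding elementary_def ext_upper_half_plane_def using Imz by blast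
qed

text \<open>\<open>R ** A ** Q\<close> is \<open>A\<close> in cone coordinates. Nonnegative entries
  keep the quadrant; for nonpositive ones the image vector is negated, which does not move the point
  of the circle.\<close>

lemma preserves_cone_imp_mobius_into:
  assumes S: "mobius_semigroup S" and "preserves_cone (lift_closure S)"
  shows "\<exists>J. closed_interval J \<and> S \<subseteq> mobius_into J"
proof -
  obtain R Q where RQ: "R ** Q = mat 1" and sgn: "\<And>A. A \<in> lift_closure S \<Longrightarrow> same_sign (R ** A ** Q)"
    using assms(2) unfolding preserves_cone_def by blast
  have QR: "Q ** R = mat 1" using RQ by (simp add: matrix_left_right_inverse)
  obtain p q r t where Q: "Q = mat2 p q r t" by (rule mat2_cases)
  have "det R * det Q = 1" using arg_cong[OF RQ, of det] by (simp add: det_mul)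
  then have detQ: "det Q \<noteq> 0" and detR: "det R \<noteq> 0" by auto
  define J where "J = (\<lambda>(x, y). rproj (vec2 (p * x + q * y) (r * x + t * y))) ` {(x, y). x \<ge> 0 \<and> y \<ge> 0 \<and> (x, y) \<noteq> (0, 0)}"
  have JI: "rproj (Q *v vec2 x y) \<in> J" if "x \<ge> 0" "y \<ge> 0" "(x, y) \<noteq> (0, 0)" for x y
    using that unfolding J_def by (intro image_eqI[of _ _ "(x, y)"]) (simp_all add: Q)
  have "closed_interval J" unfolding J_def using detQ by (intro closed_interval_cone) (simp add: Q)
  moreover have "f ` J \<subseteq> J" if "f \<in> S" for f
  proof (rule image_subsetI)
    fix z assume "z \<in> J"
    then obtain x y where xy: "x \<ge> 0" "y \<ge> 0" "(x, y) \<noteq> (0, 0)" "z = rproj (Q *v vec2 x y)"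
      unfolding J_def by (auto simp: Q)
    from S \<open>f \<in> S\<close> obtain A where A: "det A > 0" "f = mobius A" "A \<in> lift_closure S" by (rule lift_cases)
    obtain a b c d where M: "R ** A ** Q = mat2 a b c d" by (rule mat2_cases)
    have AQ: "A ** Q = Q ** (R ** A ** Q)"
      using QR by (simp add: matrix_mul_assoc)
    have v0: "vec2 x y \<noteq> 0" using xy(3) by simp
    have "Q *v vec2 x y \<noteq> 0" by (rule matrix_vector_mult_nonzero[OF detQ v0])
    then have "f z = rproj (A *v (Q *v vec2 x y))" by (simp add: A(2) xy(4) mobius_rproj)
    also have "A *v (Q *v vec2 x y) = Q *v ((R ** A ** Q) *v vec2 x y)"
      by (simp only: matrix_vector_mul_assoc AQ[symmetric])
    also have "\<dots> = Q *v vec2 (a * x + b * y) (c * x + d * y)" by (simp add: M)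
    finally have fz: "f z = rproj (Q *v vec2 (a * x + b * y) (c * x + d * y))" .
    have "det (R ** A ** Q) \<noteq> 0" using detR detQ A(1) by (simp add: det_mul)
    then have "(R ** A ** Q) *v vec2 x y \<noteq> 0" using v0 by (rule matrix_vector_mult_nonzero)
    then have nz: "(a * x + b * y, c * x + d * y) \<noteq> (0, 0)" by (simp add: M)
    have "same_sign (mat2 a b c d)" using sgn[OF A(3)] by (simp add: M)
    then consider "a \<ge> 0" "b \<ge> 0" "c \<ge> 0" "d \<ge> 0" | "a \<le> 0" "b \<le> 0" "c \<le> 0" "d \<le> 0"
      by (auto simp: same_sign_def forall_2)
    then show "f z \<in> J"
    proof cases
      case 1
      then show ?thesis unfolding fz using xy nz by (intro JI) auto
    next
      case 2
      have "f z = rproj ((- 1) *\<^sub>R (Q *v vec2 (a * x + b * y) (c * x + d * y)))"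
        unfolding fz by (subst rproj_scaleR) simp_all
      also have "(- 1) *\<^sub>R (Q *v vec2 (a * x + b * y) (c * x + d * y)) = Q *v vec2 (- (a * x + b * y)) (- (c * x + d * y))"
        by (simp add: Q algebra_simps)
      also have "rproj \<dots> \<in> J"
      proof (rule JI)
        have "a * x \<le> 0" "b * y \<le> 0" "c * x \<le> 0" "d * y \<le> 0"
          using 2 xy by (simp_all add: mult_nonpos_nonneg)
        then show "0 \<le> - (a * x + b * y)" "0 \<le> - (c * x + d * y)" by simp_all
        show "(- (a * x + b * y), - (c * x + d * y)) \<noteq> (0, 0)"
          using nz by (simp only: prod.inject neg_equal_0_iff_equal simp_thms)
      qed
      finally show ?thesis .
    qed
  qed
  ultimately show ?thesis
    using S unfolding mobius_into_def mobius_semigroup_def by blast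
qed

text \<open>Open sets of transformations have open preimages among the matrices, so density of the
  lifted set passes down to \<open>S\<close>.\<close>

lemma lift_closure_full_imp_dense:
  assumes "lift_closure S = {A. det A > 0}"
  shows "mobius_topology closure_of S = mobius_group"
proof
  show "mobius_topology closure_of S \<subseteq> mobius_group"
    using closure_of_subset_topspace[of mobius_topology S] by simp
  show "mobius_group \<subseteq> mobius_topology closure_of S"
  proof
    fix f assume f: "f \<in> mobius_group"
    then obtain A where A: "det A > 0" "f = mobius A" unfolding mobius_group_def by blast
    then have cl: "A \<in> closure {B. det B > 0 \<and> mobius B \<in> S}"
      using assms unfolding lift_closure_def by blast
    show "f \<in> mobius_topology closure_of S"
      unfolding in_closure_of
    proof (intro conjI allI impI)
      show "f \<in> topspace mobius_topology" using f by simp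
      fix U assume U: "f \<in> U \<and> openin mobius_topology U"
      then have "open {B. det B > 0 \<and> mobius B \<in> U}" by (simp add: openin_mobius_topology)
      moreover have "A \<in> {B. det B > 0 \<and> mobius B \<in> U}" using A U by simp
      ultimately obtain B where "mobius B \<in> U" "mobius B \<in> S"
        using cl unfolding closure_iff_nhds_not_empty by blast
      then show "\<exists>y. y \<in> S \<and> y \<in> U" by blast
    qed
  qed
qed

theorem theorem1p8:
  fixes S :: "(complex option \<Rightarrow> complex option) set"
  assumes "mobius_semigroup S"
  shows "elementary S \<or>
    semidiscrete S \<or>
    (\<exists>J. closed_interval J \<and> S \<subseteq> mobius_into J) \<or>
    mobius_topology closure_of S = mobius_group"
proof (cases "semidiscrete S")
  case False
  interpret matrix_semigroup "lift_closure S"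
    by (rule matrix_semigroup_lift_closure[OF assms False])
  have "alternatives (lift_closure S)"
  proof (rule nondiscrete_imp_alternatives)
    fix e :: real assume "e > 0"
    from near_identity[OF False this] lift_closureI
    show "\<exists>a b c d. mat2 a b c d \<in> lift_closure S \<and> \<bar>a - 1\<bar> < e \<and> \<bar>b\<bar> < e \<and> \<bar>c\<bar> < e \<and> \<bar>d - 1\<bar> < e
      \<and> (a \<noteq> d \<or> b \<noteq> 0 \<or> c \<noteq> 0)"
      by meson
  qed
  then show ?thesis
    unfolding alternatives_def
    using finite_real_orbit_imp_elementary[OF assms] commutes_with_rotation_imp_elementary[OF assms]
      preserves_cone_imp_mobius_into[OF assms] lift_closure_full_imp_dense by blast
qed simp

end
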